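(* Let $\mathcal X,\mathcal Y$ be finite sets and let $\pi=\pi_{XY}$ be a probability distribution on $\mathcal X\times\mathcal Y$. Then the exact common information of $\pi$ satisfies $$C_{\mathrm{Exact}}(\pi)=\Gamma(\pi).$$
   Context: All logarithms are natural; conventions $0\log 0=0$ and $0\cdot\infty=0$. $H$ denotes Shannon entropy. Exact common information: for a distribution $\pi$ on $\mathcal X\times\mathcal Y$, let $\pi^{\otimes n}$ be the distribution of $(X^n,Y^n)$ on $\mathcal X^n\times\mathcal Y^n$ with probability $\prod_{i=1}^n\pi(x_i,y_i)$. Define $$C_{\mathrm{Exact}}(\pi):=\lim_{n\to\infty}\frac1n\inf\big\{H(W): P_{X^nY^n}=\pi^{\otimes n},\ X^n-W-Y^n\big\},$$ where the infimum is over discrete random variables $W$ and conditional distributions $P_{X^n|W},P_{Y^n|W}$ such that $\sum_w P_W(w)P_{X^n|W=w}P_{Y^n|W=w}=\pi^{\otimes n}$ (so $X^n$ and $Y^n$ are conditionally independent given $W$). The functional $\Gamma$: for probability distributions $P$ on $\mathcal X$ and $Q$ on $\mathcal Y$, let $\mathcal C(P,Q)$ be the set of couplings of $P$ and $Q$. For a cost $c:\mathcal X\times\mathcal Y\to[0,\infty]$ define $$\mathcal T_c(P,Q):=\sup_{R\in\mathcal C(P,Q)}\mathbb E_R[c(X,Y)],\qquad \Phi_c(P,Q):=\mathcal T_c(P,Q)-H(P)-H(Q).$$ Put $c_\pi(x,y):=\log\frac1{\pi(x,y)}$, with $c_\pi(x,y)=+\infty$ when $\pi(x,y)=0$, and define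 $$\Gamma(\pi):=\inf\ \mathbb E_W\big[\Phi_{c_\pi}(P_{X|W},P_{Y|W})\big]=\inf\ \sum_w P_W(w)\,\Phi_{c_\pi}(P_{X|W=w},P_{Y|W=w}),$$ where the infimum is over all joint distributions of the form $P_{WXY}=P_WP_{X|W}P_{Y|W}$ with $W$ taking values in an arbitrary finite alphabet and $P_{XY}=\pi$. *)

theory Defs
  imports "HOL-Probability.Probability"
begin

(* The entropy of the library is real-valued and therefore 0 in the divergent case; here it takes
   values in [0,\<infinity>]. The convention 0 log 0 = 0 holds because the factor pmf p x vanishes. *)
definition shannon_entropy :: "'a pmf \<Rightarrow> ennreal" where
  "shannon_entropy p = (\<integral>\<^sup>+ x. ennreal (- (pmf p x * ln (pmf p x))) \<partial>count_space UNIV)"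

(* W -- as a distribution -- together with the kernels P (for X given W) and Q (for Y given W)
   makes X - W - Y a Markov chain with (X,Y) distributed as p, i.e.
   \<Sum>w. W(w) P(x|w) Q(y|w) = p(x,y). The kernels are irrelevant outside the support of W. *)
definition markov_decomposition ::
    "('a \<times> 'b) pmf \<Rightarrow> 'w pmf \<Rightarrow> ('w \<Rightarrow> 'a pmf) \<Rightarrow> ('w \<Rightarrow> 'b pmf) \<Rightarrow> bool" where
  "markov_decomposition p W P Q \<longleftrightarrow> bind_pmf W (\<lambda>w. pair_pmf (P w) (Q w)) = p"

definition iid_pair :: "nat \<Rightarrow> ('a \<times> 'b) pmf \<Rightarrow> ('a list \<times> 'b list) pmf" where
  "iid_pair n p = map_pmf (\<lambda>zs. (map fst zs, map snd zs)) (replicate_pmf n p)"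

lemma pmf_replicate_pmf:
  "pmf (replicate_pmf n p) zs = (if length zs = n then \<Prod>i<n. pmf p (zs ! i) else 0)"
proof (induction n arbitrary: zs)
  case 0
  then show ?case by (auto simp: pmf_return indicator_def)
next
  case (Suc n)
  have eq: "replicate_pmf (Suc n) p = map_pmf (\<lambda>(x, xs). x # xs) (pair_pmf p (replicate_pmf n p))"
    by (simp add: pair_pmf_def map_bind_pmf bind_return_pmf)
  show ?case
  proof (cases zs)
    case Nil
    have "[] \<notin> set_pmf (replicate_pmf (Suc n) p)"
      unfolding set_replicate_pmf by simp
    then have "pmf (replicate_pmf (Suc n) p) [] = 0"
      by (simp only: set_pmf_iff not_not)
    then show ?thesis using Nil by simp
  next
    case (Cons a as)
    have "inj (\<lambda>(x, xs). x # xs)" by (auto simp: inj_on_def)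
    from pmf_map_inj'[OF this, of "pair_pmf p (replicate_pmf n p)" "(a, as)"]
    have "pmf (replicate_pmf (Suc n) p) zs = pmf p a * pmf (replicate_pmf n p) as"
      unfolding eq Cons by (simp add: pmf_pair)
    also have "\<dots> = (if length zs = Suc n then \<Prod>i<Suc n. pmf p (zs ! i) else 0)"
      unfolding Suc.IH prod.lessThan_Suc_shift by (simp add: Cons)
    finally show ?thesis .
  qed
qed

lemma pmf_iid_pair:
  assumes "length xs = n" "length ys = n"
  shows "pmf (iid_pair n p) (xs, ys) = (\<Prod>i<n. pmf p (xs ! i, ys ! i))"
proof -
  let ?f = "\<lambda>zs. (map fst zs, map snd zs)"
  have inj: "inj ?f"
    by (rule injI) (metis prod.inject zip_map_fst_snd)
  have zip: "?f (zip xs ys) = (xs, ys)"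
    using assms by simp
  have "pmf (iid_pair n p) (?f (zip xs ys)) = pmf (replicate_pmf n p) (zip xs ys)"
    unfolding iid_pair_def by (rule pmf_map_inj'[OF inj])
  then show ?thesis
    unfolding zip using assms by (simp add: pmf_replicate_pmf)
qed

(* A discrete random variable has a countable alphabet, so its values may be taken in nat. *)
definition exact_rate :: "('a \<times> 'b) pmf \<Rightarrow> nat \<Rightarrow> ereal" where
  "exact_rate p n =
     enn2ereal (INF (W, P, Q) \<in> {(W :: nat pmf, P, Q). markov_decomposition (iid_pair n p) W P Q}.
       shannon_entropy W) / ereal (real n)"

definition exact_common_information :: "('a \<times> 'b) pmf \<Rightarrow> ereal" where
  "exact_common_information p = lim (exact_rate p)"

definition couplings :: "'a pmf \<Rightarrow> 'b pmf \<Rightarrow> ('a \<times> 'b) pmf set" where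
  "couplings P Q = {R. map_pmf fst R = P \<and> map_pmf snd R = Q}"

definition max_transport :: "('a \<Rightarrow> 'b \<Rightarrow> ennreal) \<Rightarrow> 'a pmf \<Rightarrow> 'b pmf \<Rightarrow> ennreal" where
  "max_transport c P Q = (SUP R \<in> couplings P Q. \<integral>\<^sup>+ (x, y). c x y \<partial>measure_pmf R)"

(* The alphabets are finite, so both entropies are finite and no \<infinity> - \<infinity> occurs. *)
definition Phi ::
    "('a::finite \<Rightarrow> 'b::finite \<Rightarrow> ennreal) \<Rightarrow> 'a pmf \<Rightarrow> 'b pmf \<Rightarrow> ereal" where
  "Phi c P Q = enn2ereal (max_transport c P Q)
     - enn2ereal (shannon_entropy P) - enn2ereal (shannon_entropy Q)"

definition log_cost :: "('a \<times> 'b) pmf \<Rightarrow> 'a \<Rightarrow> 'b \<Rightarrow> ennreal" where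
  "log_cost p x y = (if pmf p (x, y) = 0 then \<infinity> else ennreal (ln (1 / pmf p (x, y))))"

(* Finite alphabets for W are encoded as finite supports in nat; Phi never takes the
   value -\<infinity>, so the sum is the usual one in (-\<infinity>,\<infinity>]. *)
definition Gamma_functional :: "('a::finite \<times> 'b::finite) pmf \<Rightarrow> ereal" where
  "Gamma_functional p =
     (INF (W, P, Q) \<in> {(W :: nat pmf, P, Q). finite (set_pmf W) \<and> markov_decomposition p W P Q}.
       \<Sum>w\<in>set_pmf W. ereal (pmf W w) * Phi (log_cost p) (P w) (Q w))"

lemma shannon_entropy_finite:
  fixes p :: "'a::finite pmf"
  shows "shannon_entropy p = ennreal (- (\<Sum>x\<in>UNIV. pmf p x * ln (pmf p x)))"
proof -
  have "0 \<le> - (pmf p x * ln (pmf p x))" for x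
    by (cases "pmf p x = 0") (auto simp: mult_nonneg_nonpos pmf_le_1 pmf_pos)
  then show ?thesis
    unfolding shannon_entropy_def
    by (simp add: nn_integral_count_space_finite sum_ennreal del: neg_0_le_iff_le
        flip: sum_negf)
qed

end

theory Submission
  imports Defs
begin

text \<open>
  Converse. If \<open>\<pi>\<^sup>n\<close> is decomposed through \<open>W\<close>, then
  \<open>P(w) P(x|w) Q(y|w) \<le> \<pi>\<^sup>n(x,y)\<close>; taking logarithms and averaging over the costliest coupling of
  the two kernels gives \<open>- log P(w) \<ge> \<Phi>(P(.|w), Q(.|w))\<close>. By convex duality it suffices to bound
  \<open>\<Phi>\<close> from below by \<open>E \<phi>(X,Y)\<close> under the product \<open>P \<otimes> Q\<close>, for functions \<open>\<phi>\<close> with this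
  property for one letter, and this property tensorizes. The point is to use the chain rule in opposite
  orders, \<open>H(X1 X2) = H(X1) + H(X2|X1)\<close> and \<open>H(Y1 Y2) = H(Y2) + H(Y1|Y2)\<close>: draw \<open>x1\<close> and \<open>y2\<close>
  independently, then \<open>y1\<close> from the best coupling of \<open>X1\<close> with \<open>Y1\<close> given \<open>y2\<close>, and \<open>x2\<close> from the
  best coupling of \<open>X2\<close> given \<open>x1\<close> with \<open>Y2\<close>.

  Achievability. Kantorovich potentials \<open>f\<close>, \<open>g\<close> for each \<open>w\<close> reduce typicality to laws of large
  numbers for \<open>f + log P\<close> and \<open>g + log Q\<close>: on the typical sets
  \<open>P(x|w) Q(y|w) \<le> exp(n (\<Gamma> + \<epsilon>)) \<pi>\<^sup>n(x,y)\<close>. A uniform codebook of about \<open>exp(n (\<Gamma> + \<epsilon>))\<close>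
  words \<open>w\<close>, chosen greedily along an exponential potential, then averages to at most
  \<open>(1 + \<eta>) \<pi>\<^sup>n\<close> pointwise; the small remainder is described by sending \<open>(x,y)\<close> itself.
\<close>

section \<open>Entropy, couplings and tensorization\<close>

abbreviation expect :: "'a pmf \<Rightarrow> ('a \<Rightarrow> real) \<Rightarrow> real" where
  "expect \<equiv> measure_pmf.expectation"

text \<open>A real-valued counterpart of \<open>shannon_entropy\<close>, so that differences can be
  formed. The two agree on finite supports, see \<open>shannon_entropy_eq_ent\<close>.\<close>

definition ent :: "'a pmf \<Rightarrow> real" where
  "ent p = expect p (\<lambda>x. - ln (pmf p x))"

lemma expect_bind_finite:
  assumes "finite (set_pmf p)" "\<And>x. x \<in> set_pmf p \<Longrightarrow> finite (set_pmf (f x))"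
  shows "expect (bind_pmf p f) h = expect p (\<lambda>x. expect (f x) h)"
  using assms
  by (subst pmf_expectation_bind[where A = "set_pmf p"])
     (auto simp: integral_measure_pmf_real[where A = "set_pmf p"] mult.commute)

lemma expect_cong_pmf:
  assumes "\<And>x. x \<in> set_pmf p \<Longrightarrow> f x = g x"
  shows "expect p f = expect p g"
  using assms by (intro integral_cong_AE) (auto simp: AE_measure_pmf_iff)

lemma expect_mono_finite:
  assumes "finite (set_pmf p)" "\<And>x. x \<in> set_pmf p \<Longrightarrow> f x \<le> g x"
  shows "expect p f \<le> expect p g"
  using assms
  by (intro integral_mono_AE) (auto simp: AE_measure_pmf_iff intro: integrable_measure_pmf_finite)

lemma expect_add_finite:
  assumes "finite (set_pmf p)"
  shows "expect p (\<lambda>x. f x + g x) = expect p f + expect p g"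
  using assms by (intro Bochner_Integration.integral_add integrable_measure_pmf_finite)

text \<open>Unspecified where the first marginal vanishes; it is only evaluated on the support of
  that marginal.\<close>

definition cond_kernel :: "('a \<times> 'b) pmf \<Rightarrow> 'a \<Rightarrow> 'b pmf" where
  "cond_kernel R x = map_pmf snd (cond_pmf R {z. fst z = x})"

lemma bind_cond_kernel:
  "bind_pmf (map_pmf fst R) (\<lambda>x. map_pmf (Pair x) (cond_kernel R x)) = R"
proof -
  have ne: "set_pmf R \<inter> {z. fst z = x} \<noteq> {}" if "x \<in> set_pmf (map_pmf fst R)" for x
    using that by auto
  have "bind_pmf (map_pmf fst R) (\<lambda>x. map_pmf (Pair x) (cond_kernel R x))
      = bind_pmf (map_pmf fst R) (\<lambda>x. cond_pmf R {z. fst z = x})"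
  proof (intro bind_pmf_cong refl)
    fix x assume x: "x \<in> set_pmf (map_pmf fst R)"
    have "map_pmf (Pair x) (cond_kernel R x) = map_pmf (\<lambda>z. z) (cond_pmf R {z. fst z = x})"
      unfolding cond_kernel_def pmf.map_comp
      by (rule map_pmf_cong) (auto simp: set_cond_pmf[OF ne[OF x]])
    then show "map_pmf (Pair x) (cond_kernel R x) = cond_pmf R {z. fst z = x}" by simp
  qed
  also have "\<dots> = R"
    by (intro bind_cond_pmf_cancel) (auto simp: measure_map_pmf vimage_def intro!: arg_cong[where f = "measure R"])
  finally show ?thesis .
qed

lemma set_cond_kernel:
  assumes "x \<in> fst ` set_pmf R"
  shows "set_pmf (cond_kernel R x) = {y. (x, y) \<in> set_pmf R}"
proof -
  have ne: "set_pmf R \<inter> {z. fst z = x} \<noteq> {}" using assms by auto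
  show ?thesis unfolding cond_kernel_def by (force simp: set_cond_pmf[OF ne] image_iff)
qed

lemma finite_set_cond_kernel:
  assumes "finite (set_pmf R)" "x \<in> fst ` set_pmf R"
  shows "finite (set_pmf (cond_kernel R x))"
proof -
  have "{y. (x, y) \<in> set_pmf R} \<subseteq> snd ` set_pmf R" by force
  then show ?thesis using assms by (auto simp: set_cond_kernel intro: finite_subset)
qed

lemma pmf_cond_kernel:
  assumes "(x, y) \<in> set_pmf R"
  shows "pmf R (x, y) = pmf (map_pmf fst R) x * pmf (cond_kernel R x) y"
proof -
  have ne: "set_pmf R \<inter> {z. fst z = x} \<noteq> {}" using assms by force
  have inj: "inj_on snd (set_pmf (cond_pmf R {z. fst z = x}))"
    by (auto simp: inj_on_def set_cond_pmf[OF ne])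
  have pos: "measure R {z. fst z = x} > 0"
    using assms by (rule measure_pmf_posI) simp
  have "pmf (cond_kernel R x) y = pmf (cond_pmf R {z. fst z = x}) (x, y)"
  proof -
    have "(x, y) \<in> set_pmf (cond_pmf R {z. fst z = x})"
      using assms by (simp add: set_cond_pmf[OF ne])
    from pmf_map_inj[OF inj this] show ?thesis by (simp only: cond_kernel_def snd_conv)
  qed
  also have "\<dots> = pmf R (x, y) / measure R {z. fst z = x}"
    by (simp add: pmf_cond[OF ne])
  finally have "pmf (cond_kernel R x) y = pmf R (x, y) / measure R {z. fst z = x}" .
  moreover have "pmf (map_pmf fst R) x = measure R {z. fst z = x}"
    by (simp add: pmf_map vimage_def)
  ultimately show ?thesis using pos by simp
qed

text \<open>Split \<open>- ln (pmf R (x, y))\<close> into its marginal and conditional parts and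
  average. Applied to \<open>P\<close> as it stands and to \<open>Q\<close> with swapped
  coordinates, this yields the two opposite orders of expansion.\<close>

lemma ent_chain:
  assumes fin: "finite (set_pmf R)"
  shows "ent R = ent (map_pmf fst R) + expect (map_pmf fst R) (\<lambda>x. ent (cond_kernel R x))"
proof -
  let ?P = "map_pmf fst R"
  have finP: "finite (set_pmf ?P)" using fin by simp
  have finK: "finite (set_pmf (cond_kernel R x))" if "x \<in> set_pmf ?P" for x
    using that fin by (intro finite_set_cond_kernel) auto
  have "ent R = expect (bind_pmf ?P (\<lambda>x. map_pmf (Pair x) (cond_kernel R x))) (\<lambda>z. - ln (pmf R z))"
    by (simp add: ent_def bind_cond_kernel)
  also have "\<dots> = expect ?P (\<lambda>x. expect (cond_kernel R x) (\<lambda>y. - ln (pmf R (x, y))))"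
    using finP finK by (subst expect_bind_finite) auto
  also have "\<dots> = expect ?P (\<lambda>x. - ln (pmf ?P x) + ent (cond_kernel R x))"
  proof (rule expect_cong_pmf)
    fix x assume x: "x \<in> set_pmf ?P"
    have "expect (cond_kernel R x) (\<lambda>y. - ln (pmf R (x, y)))
        = expect (cond_kernel R x) (\<lambda>y. - ln (pmf ?P x) + - ln (pmf (cond_kernel R x) y))"
    proof (rule expect_cong_pmf)
      fix y assume y: "y \<in> set_pmf (cond_kernel R x)"
      then have "(x, y) \<in> set_pmf R" using x by (subst (asm) set_cond_kernel) auto
      then show "- ln (pmf R (x, y)) = - ln (pmf ?P x) + - ln (pmf (cond_kernel R x) y)"
        using pmf_positive[OF x] pmf_positive[OF y] by (simp only: pmf_cond_kernel ln_mult) simp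
    qed
    also have "\<dots> = - ln (pmf ?P x) + ent (cond_kernel R x)"
      using finK[OF x] by (subst expect_add_finite) (auto simp: ent_def)
    finally show "expect (cond_kernel R x) (\<lambda>y. - ln (pmf R (x, y))) = \<dots>" .
  qed
  also have "\<dots> = ent ?P + expect ?P (\<lambda>x. ent (cond_kernel R x))"
    by (subst expect_add_finite[OF finP]) (auto simp: ent_def)
  finally show ?thesis .
qed

lemma ent_map_inj:
  assumes "inj_on f (set_pmf p)"
  shows "ent (map_pmf f p) = ent p"
  unfolding ent_def by (simp, rule expect_cong_pmf) (simp add: pmf_map_inj[OF assms])

text \<open>
  This says \<open>E \<phi> \<le> \<Phi>\<^sub>c(P, Q)\<close> under \<open>P \<otimes> Q\<close>, with a single coupling in place of the
  supremum in \<open>\<T>\<^sub>c\<close>; \<open>A\<close> is the set where \<open>c\<close> is finite.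
\<close>
definition coupling_bound ::
    "('a \<Rightarrow> 'b \<Rightarrow> bool) \<Rightarrow> ('a \<times> 'b \<Rightarrow> real) \<Rightarrow> ('a \<times> 'b \<Rightarrow> real) \<Rightarrow> bool" where
  "coupling_bound A c \<phi> \<longleftrightarrow> (\<forall>P Q. finite (set_pmf P) \<longrightarrow> finite (set_pmf Q) \<longrightarrow>
     (\<forall>x\<in>set_pmf P. \<forall>y\<in>set_pmf Q. A x y) \<longrightarrow>
     (\<exists>R\<in>couplings P Q. ent P + ent Q + expect (pair_pmf P Q) \<phi> \<le> expect R c))"

lemma set_pmf_coupling:
  assumes "R \<in> couplings P Q"
  shows "set_pmf R \<subseteq> set_pmf P \<times> set_pmf Q"
  using assms unfolding couplings_def by (force simp: mem_Times_iff)

lemma finite_coupling: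
  assumes "R \<in> couplings P Q" "finite (set_pmf P)" "finite (set_pmf Q)"
  shows "finite (set_pmf R)"
  using set_pmf_coupling[OF assms(1)] assms(2,3) by (meson finite_SigmaI finite_subset)

text \<open>Crossing the orders makes the two bounds composable: the law of \<open>x1\<close> is the
  same for every \<open>y2\<close>, and that of \<open>y2\<close> the same for every
  \<open>x1\<close>. So the couplings of \<open>P1\<close> with \<open>L y2\<close> and of
  \<open>K x1\<close> with \<open>Q2\<close> can be realised together once \<open>x1\<close> and
  \<open>y2\<close> are drawn independently, and the entropies add up by
  \<open>ent_chain\<close>.\<close>

lemma coupling_bound_pair:
  fixes c1 \<phi>1 :: "'a \<times> 'b \<Rightarrow> real" and c2 \<phi>2 :: "'c \<times> 'd \<Rightarrow> real"
  assumes cb1: "coupling_bound A1 c1 \<phi>1" and cb2: "coupling_bound A2 c2 \<phi>2"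
  shows "coupling_bound (\<lambda>(x1, x2) (y1, y2). A1 x1 y1 \<and> A2 x2 y2)
    (\<lambda>((x1, x2), (y1, y2)). c1 (x1, y1) + c2 (x2, y2))
    (\<lambda>((x1, x2), (y1, y2)). \<phi>1 (x1, y1) + \<phi>2 (x2, y2))"
  unfolding coupling_bound_def
proof (intro allI impI)
  fix P :: "('a \<times> 'c) pmf" and Q :: "('b \<times> 'd) pmf"
  assume finP: "finite (set_pmf P)" and finQ: "finite (set_pmf Q)"
    and A: "\<forall>x\<in>set_pmf P. \<forall>y\<in>set_pmf Q.
      (case x of (x1, x2) \<Rightarrow> \<lambda>(y1, y2). A1 x1 y1 \<and> A2 x2 y2) y"
  define Q' where "Q' = map_pmf prod.swap Q"
  define P1 where "P1 = map_pmf fst P"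
  define Q2 where "Q2 = map_pmf snd Q"
  define K where "K = cond_kernel P"
  define L where "L = cond_kernel Q'"
  have finQ': "finite (set_pmf Q')" using finQ by (simp add: Q'_def)
  have Q2: "Q2 = map_pmf fst Q'"
    by (simp add: Q2_def Q'_def pmf.map_comp o_def)
  have finP1: "finite (set_pmf P1)" and finQ2: "finite (set_pmf Q2)"
    using finP finQ by (auto simp: P1_def Q2_def)
  have P_eq: "bind_pmf P1 (\<lambda>x. map_pmf (Pair x) (K x)) = P"
    unfolding P1_def K_def by (rule bind_cond_kernel)
  have "bind_pmf Q2 (\<lambda>y. map_pmf (Pair y) (L y)) = Q'"
    unfolding Q2 L_def by (rule bind_cond_kernel)
  then have "map_pmf prod.swap (bind_pmf Q2 (\<lambda>y. map_pmf (Pair y) (L y))) = Q"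
    by (simp add: Q'_def pmf.map_comp o_def)
  then have Q_eq: "bind_pmf Q2 (\<lambda>y2. map_pmf (\<lambda>y1. (y1, y2)) (L y2)) = Q"
    by (simp add: map_bind_pmf pmf.map_comp o_def)
  have finK: "finite (set_pmf (K x))" if "x \<in> set_pmf P1" for x
    using that finP unfolding K_def P1_def by (intro finite_set_cond_kernel) auto
  have finL: "finite (set_pmf (L y))" if "y \<in> set_pmf Q2" for y
    using that finQ' unfolding L_def Q2 by (intro finite_set_cond_kernel) auto
  have setK: "(x, z) \<in> set_pmf P" if "x \<in> set_pmf P1" "z \<in> set_pmf (K x)" for x z
    using that unfolding K_def P1_def by (subst (asm) set_cond_kernel) auto
  have setL: "(z, y) \<in> set_pmf Q" if "y \<in> set_pmf Q2" "z \<in> set_pmf (L y)" for y z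
    using that unfolding L_def Q2 by (subst (asm) set_cond_kernel) (auto simp: Q'_def)
  have "\<forall>y\<in>set_pmf Q2. \<exists>R\<in>couplings P1 (L y).
      ent P1 + ent (L y) + expect (pair_pmf P1 (L y)) \<phi>1 \<le> expect R c1"
  proof
    fix y assume y: "y \<in> set_pmf Q2"
    have "\<forall>x\<in>set_pmf P1. \<forall>z\<in>set_pmf (L y). A1 x z"
      using A setL[OF y] by (fastforce simp: P1_def)
    then show "\<exists>R\<in>couplings P1 (L y).
      ent P1 + ent (L y) + expect (pair_pmf P1 (L y)) \<phi>1 \<le> expect R c1"
      using cb1 finP1 finL[OF y] unfolding coupling_bound_def by blast
  qed
  then obtain R1 where R1: "\<And>y. y \<in> set_pmf Q2 \<Longrightarrow> R1 y \<in> couplings P1 (L y)"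
    "\<And>y. y \<in> set_pmf Q2 \<Longrightarrow>
      ent P1 + ent (L y) + expect (pair_pmf P1 (L y)) \<phi>1 \<le> expect (R1 y) c1"
    by metis
  have "\<forall>x\<in>set_pmf P1. \<exists>R\<in>couplings (K x) Q2.
      ent (K x) + ent Q2 + expect (pair_pmf (K x) Q2) \<phi>2 \<le> expect R c2"
  proof
    fix x assume x: "x \<in> set_pmf P1"
    have "\<forall>z\<in>set_pmf (K x). \<forall>y\<in>set_pmf Q2. A2 z y"
      using A setK[OF x] by (fastforce simp: Q2_def)
    then show "\<exists>R\<in>couplings (K x) Q2.
      ent (K x) + ent Q2 + expect (pair_pmf (K x) Q2) \<phi>2 \<le> expect R c2"
      using cb2 finQ2 finK[OF x] unfolding coupling_bound_def by blast
  qed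
  then obtain R2 where R2: "\<And>x. x \<in> set_pmf P1 \<Longrightarrow> R2 x \<in> couplings (K x) Q2"
    "\<And>x. x \<in> set_pmf P1 \<Longrightarrow>
      ent (K x) + ent Q2 + expect (pair_pmf (K x) Q2) \<phi>2 \<le> expect (R2 x) c2"
    by metis
  define N1 where "N1 y = cond_kernel (R1 y)" for y
  define N2 where "N2 x = cond_kernel (map_pmf prod.swap (R2 x))" for x
  have R1_eq: "bind_pmf P1 (\<lambda>x. map_pmf (Pair x) (N1 y x)) = R1 y" if "y \<in> set_pmf Q2" for y
    using bind_cond_kernel[of "R1 y"] R1(1)[OF that] by (simp add: couplings_def N1_def)
  have R2_eq: "bind_pmf Q2 (\<lambda>y. map_pmf (\<lambda>z. (z, y)) (N2 x y)) = R2 x" if "x \<in> set_pmf P1" for x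
  proof -
    have "map_pmf fst (map_pmf prod.swap (R2 x)) = Q2"
      using R2(1)[OF that] by (simp add: couplings_def pmf.map_comp o_def)
    then have "map_pmf prod.swap (bind_pmf Q2 (\<lambda>y. map_pmf (Pair y) (N2 x y)))
        = map_pmf prod.swap (map_pmf prod.swap (R2 x))"
      using bind_cond_kernel[of "map_pmf prod.swap (R2 x)"] by (simp add: N2_def)
    then show ?thesis by (simp add: map_bind_pmf pmf.map_comp o_def)
  qed
  \<comment> \<open>Forgetting \<open>y1\<close> leaves \<open>R2 x1\<close> over \<open>x1\<close>,
    and forgetting \<open>x2\<close> leaves \<open>R1 y2\<close> over \<open>y2\<close>. These two
    projections determine both marginals and both costs of \<open>M\<close>.\<close>
  define M where "M = bind_pmf P1 (\<lambda>x1. bind_pmf Q2 (\<lambda>y2. bind_pmf (N1 y2 x1) (\<lambda>y1.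
     bind_pmf (N2 x1 y2) (\<lambda>x2. return_pmf ((x1, x2), (y1, y2))))))"
  have M': "M = bind_pmf Q2 (\<lambda>y2. bind_pmf P1 (\<lambda>x1. bind_pmf (N1 y2 x1) (\<lambda>y1.
     bind_pmf (N2 x1 y2) (\<lambda>x2. return_pmf ((x1, x2), (y1, y2))))))"
    unfolding M_def by (rule bind_commute_pmf)
  have M_right: "map_pmf (\<lambda>((x1, x2), (y1, y2)). (x1, (x2, y2))) M
      = bind_pmf P1 (\<lambda>x. map_pmf (Pair x) (R2 x))"
    unfolding M_def map_bind_pmf
  proof (intro bind_pmf_cong refl)
    fix x1 assume x: "x1 \<in> set_pmf P1"
    show "bind_pmf Q2 (\<lambda>y2. bind_pmf (N1 y2 x1) (\<lambda>y1. bind_pmf (N2 x1 y2)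
        (\<lambda>x2. map_pmf (\<lambda>((x1, x2), (y1, y2)). (x1, (x2, y2))) (return_pmf ((x1, x2), (y1, y2))))))
        = map_pmf (Pair x1) (R2 x1)"
      unfolding R2_eq[OF x, symmetric] by (simp add: map_bind_pmf pmf.map_comp o_def map_pmf_def[symmetric])
  qed
  have M_left: "map_pmf (\<lambda>((x1, x2), (y1, y2)). (y2, (x1, y1))) M
      = bind_pmf Q2 (\<lambda>y. map_pmf (Pair y) (R1 y))"
    unfolding M' map_bind_pmf
  proof (intro bind_pmf_cong refl)
    fix y2 assume y: "y2 \<in> set_pmf Q2"
    show "bind_pmf P1 (\<lambda>x1. bind_pmf (N1 y2 x1) (\<lambda>y1. bind_pmf (N2 x1 y2)
        (\<lambda>x2. map_pmf (\<lambda>((x1, x2), (y1, y2)). (y2, (x1, y1))) (return_pmf ((x1, x2), (y1, y2))))))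
        = map_pmf (Pair y2) (R1 y2)"
      unfolding R1_eq[OF y, symmetric]
      by (simp add: map_bind_pmf pmf.map_comp o_def map_pmf_def[symmetric])
  qed
  have "map_pmf fst M = map_pmf (\<lambda>(x1, (x2, y2)). (x1, x2)) (map_pmf (\<lambda>((x1, x2), (y1, y2)). (x1, (x2, y2))) M)"
    by (simp add: pmf.map_comp o_def case_prod_beta)
  also have "\<dots> = bind_pmf P1 (\<lambda>x. map_pmf (Pair x) (map_pmf fst (R2 x)))"
    unfolding M_right by (simp add: map_bind_pmf pmf.map_comp o_def case_prod_beta)
  also have "\<dots> = P"
    unfolding P_eq[symmetric] using R2(1) by (intro bind_pmf_cong) (auto simp: couplings_def)
  finally have margP: "map_pmf fst M = P" .
  have "map_pmf snd M = map_pmf (\<lambda>(y2, (x1, y1)). (y1, y2)) (map_pmf (\<lambda>((x1, x2), (y1, y2)). (y2, (x1, y1))) M)"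
    by (simp add: pmf.map_comp o_def case_prod_beta)
  also have "\<dots> = bind_pmf Q2 (\<lambda>y. map_pmf (\<lambda>z. (z, y)) (map_pmf snd (R1 y)))"
    unfolding M_left by (simp add: map_bind_pmf pmf.map_comp o_def case_prod_beta)
  also have "\<dots> = Q"
    unfolding Q_eq[symmetric] using R1(1) by (intro bind_pmf_cong) (auto simp: couplings_def)
  finally have margQ: "map_pmf snd M = Q" .
  have M: "M \<in> couplings P Q" using margP margQ by (simp add: couplings_def)
  have finM: "finite (set_pmf M)" by (rule finite_coupling[OF M finP finQ])
  have finR1: "finite (set_pmf (R1 y))" if "y \<in> set_pmf Q2" for y
    using finite_coupling[OF R1(1)[OF that] finP1 finL[OF that]] .
  have finR2: "finite (set_pmf (R2 x))" if "x \<in> set_pmf P1" for x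
    using finite_coupling[OF R2(1)[OF that] finK[OF that] finQ2] .
  have "expect M (\<lambda>((x1, x2), (y1, y2)). c1 (x1, y1))
      = expect (map_pmf (\<lambda>((x1, x2), (y1, y2)). (y2, (x1, y1))) M) (\<lambda>(y, z). c1 z)"
    by (simp add: case_prod_unfold)
  also have "\<dots> = expect Q2 (\<lambda>y. expect (R1 y) c1)"
    unfolding M_left using finQ2 finR1 by (subst expect_bind_finite) auto
  finally have cost1: "expect M (\<lambda>((x1, x2), (y1, y2)). c1 (x1, y1)) = expect Q2 (\<lambda>y. expect (R1 y) c1)" .
  have "expect Q2 (\<lambda>y. expect (pair_pmf P1 (L y)) \<phi>1)
      = expect (bind_pmf Q2 (\<lambda>y. pair_pmf P1 (L y))) \<phi>1"
    using finQ2 finP1 finL by (subst expect_bind_finite) auto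
  \<comment> \<open>This is why the test function is averaged under a product law: \<open>P1\<close>
    does not depend on \<open>y\<close>, so averaging over the conditioning gives again a product,
    that of the first-letter marginals.\<close>
  also have "bind_pmf Q2 (\<lambda>y. pair_pmf P1 (L y)) = pair_pmf (map_pmf fst P) (map_pmf fst Q)"
  proof -
    have "map_pmf fst Q = bind_pmf Q2 L"
      unfolding Q_eq[symmetric] by (simp add: map_bind_pmf pmf.map_comp o_def)
    moreover have "bind_pmf Q2 (\<lambda>y. pair_pmf P1 (L y)) = pair_pmf P1 (bind_pmf Q2 L)"
      unfolding pair_pmf_def bind_assoc_pmf by (rule bind_commute_pmf)
    ultimately show ?thesis by (simp add: P1_def)
  qed
  also have "\<dots> = map_pmf (\<lambda>((x1, x2), (y1, y2)). (x1, y1)) (pair_pmf P Q)"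
    using map_pair[of fst fst P Q] by (simp only: case_prod_unfold)
  finally have phi1: "expect Q2 (\<lambda>y. expect (pair_pmf P1 (L y)) \<phi>1)
      = expect (pair_pmf P Q) (\<lambda>((x1, x2), (y1, y2)). \<phi>1 (x1, y1))"
    by (simp add: case_prod_unfold)
  have "expect Q2 (\<lambda>y. ent P1 + (ent (L y) + expect (pair_pmf P1 (L y)) \<phi>1))
      \<le> expect Q2 (\<lambda>y. expect (R1 y) c1)"
    using R1(2) by (intro expect_mono_finite[OF finQ2]) (simp add: add.assoc)
  then have left: "ent P1 + (expect Q2 (\<lambda>y. ent (L y))
      + expect (pair_pmf P Q) (\<lambda>((x1, x2), (y1, y2)). \<phi>1 (x1, y1)))
      \<le> expect M (\<lambda>((x1, x2), (y1, y2)). c1 (x1, y1))"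
    unfolding cost1 phi1[symmetric] by (simp add: expect_add_finite[OF finQ2])
  have "expect M (\<lambda>((x1, x2), (y1, y2)). c2 (x2, y2))
      = expect (map_pmf (\<lambda>((x1, x2), (y1, y2)). (x1, (x2, y2))) M) (\<lambda>(y, z). c2 z)"
    by (simp add: case_prod_unfold)
  also have "\<dots> = expect P1 (\<lambda>x. expect (R2 x) c2)"
    unfolding M_right using finP1 finR2 by (subst expect_bind_finite) auto
  finally have cost2: "expect M (\<lambda>((x1, x2), (y1, y2)). c2 (x2, y2)) = expect P1 (\<lambda>x. expect (R2 x) c2)" .
  have "expect P1 (\<lambda>x. expect (pair_pmf (K x) Q2) \<phi>2)
      = expect (bind_pmf P1 (\<lambda>x. pair_pmf (K x) Q2)) \<phi>2"
    using finP1 finQ2 finK by (subst expect_bind_finite) auto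
  also have "bind_pmf P1 (\<lambda>x. pair_pmf (K x) Q2) = pair_pmf (map_pmf snd P) (map_pmf snd Q)"
  proof -
    have "map_pmf snd P = bind_pmf P1 K"
      unfolding P_eq[symmetric] by (simp add: map_bind_pmf pmf.map_comp o_def)
    then show ?thesis
      by (simp add: pair_pmf_def Q2_def bind_assoc_pmf)
  qed
  also have "\<dots> = map_pmf (\<lambda>((x1, x2), (y1, y2)). (x2, y2)) (pair_pmf P Q)"
    using map_pair[of snd snd P Q] by (simp only: case_prod_unfold)
  finally have phi2: "expect P1 (\<lambda>x. expect (pair_pmf (K x) Q2) \<phi>2)
      = expect (pair_pmf P Q) (\<lambda>((x1, x2), (y1, y2)). \<phi>2 (x2, y2))"
    by (simp add: case_prod_unfold)
  have "expect P1 (\<lambda>x. ent Q2 + (ent (K x) + expect (pair_pmf (K x) Q2) \<phi>2))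
      \<le> expect P1 (\<lambda>x. expect (R2 x) c2)"
    using R2(2) by (intro expect_mono_finite[OF finP1]) (simp add: algebra_simps)
  then have right: "ent Q2 + (expect P1 (\<lambda>x. ent (K x))
      + expect (pair_pmf P Q) (\<lambda>((x1, x2), (y1, y2)). \<phi>2 (x2, y2)))
      \<le> expect M (\<lambda>((x1, x2), (y1, y2)). c2 (x2, y2))"
    unfolding cost2 phi2[symmetric] by (simp add: expect_add_finite[OF finP1])
  have entP: "ent P = ent P1 + expect P1 (\<lambda>x. ent (K x))"
    unfolding P1_def K_def by (rule ent_chain[OF finP])
  have "ent Q = ent Q'" unfolding Q'_def by (rule ent_map_inj[symmetric]) simp
  also have "\<dots> = ent Q2 + expect Q2 (\<lambda>y. ent (L y))"
    unfolding Q2 L_def by (rule ent_chain[OF finQ'])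
  finally have entQ: "ent Q = ent Q2 + expect Q2 (\<lambda>y. ent (L y))" .
  have finPQ: "finite (set_pmf (pair_pmf P Q))" using finP finQ by simp
  have "ent P + ent Q + expect (pair_pmf P Q) (\<lambda>((x1, x2), (y1, y2)). \<phi>1 (x1, y1) + \<phi>2 (x2, y2))
      \<le> expect M (\<lambda>((x1, x2), (y1, y2)). c1 (x1, y1) + c2 (x2, y2))"
    using left right unfolding entP entQ
    by (simp add: case_prod_unfold expect_add_finite[OF finPQ] expect_add_finite[OF finM])
  then show "\<exists>R\<in>couplings P Q. ent P + ent Q
       + expect (pair_pmf P Q) (\<lambda>((x1, x2), (y1, y2)). \<phi>1 (x1, y1) + \<phi>2 (x2, y2))
      \<le> expect R (\<lambda>((x1, x2), (y1, y2)). c1 (x1, y1) + c2 (x2, y2))"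
    using M by blast
qed

text \<open>Induction on \<open>n\<close>, with the head as first letter and the tail as second. The
  lengths belong to the relation because splitting into head and tail is injective on nonempty lists
  only.\<close>

lemma coupling_bound_lists:
  assumes cb: "coupling_bound A c \<phi>"
  shows "coupling_bound (\<lambda>xs ys. length xs = n \<and> length ys = n \<and> (\<forall>i<n. A (xs ! i) (ys ! i)))
    (\<lambda>(xs, ys). \<Sum>i<n. c (xs ! i, ys ! i)) (\<lambda>(xs, ys). \<Sum>i<n. \<phi> (xs ! i, ys ! i))"
proof (induction n)
  case 0
  show ?case unfolding coupling_bound_def
  proof (intro allI impI)
    fix P :: "'a list pmf" and Q :: "'b list pmf"
    assume "\<forall>x\<in>set_pmf P. \<forall>y\<in>set_pmf Q. length x = 0 \<and> length y = 0 \<and> (\<forall>i<0. A (x ! i) (y ! i))"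
    then have "set_pmf P \<subseteq> {[]}" "set_pmf Q \<subseteq> {[]}"
      using set_pmf_not_empty[of P] set_pmf_not_empty[of Q] by auto
    then have "P = return_pmf []" "Q = return_pmf []" by (simp_all add: set_pmf_subset_singleton)
    then show "\<exists>R\<in>couplings P Q. ent P + ent Q
        + expect (pair_pmf P Q) (\<lambda>(xs, ys). \<Sum>i<0. \<phi> (xs ! i, ys ! i))
        \<le> expect R (\<lambda>(xs, ys). \<Sum>i<0. c (xs ! i, ys ! i))"
      by (intro bexI[of _ "return_pmf ([], [])"]) (auto simp: couplings_def ent_def)
  qed
next
  case (Suc n)
  note cb2 = coupling_bound_pair[OF cb Suc.IH]
  show ?case unfolding coupling_bound_def
  proof (intro allI impI)
    fix P :: "'a list pmf" and Q :: "'b list pmf"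
    assume finP: "finite (set_pmf P)" and finQ: "finite (set_pmf Q)"
      and A: "\<forall>x\<in>set_pmf P. \<forall>y\<in>set_pmf Q. length x = Suc n \<and> length y = Suc n
        \<and> (\<forall>i<Suc n. A (x ! i) (y ! i))"
    define P' where "P' = map_pmf (\<lambda>l. (hd l, tl l)) P"
    define Q' where "Q' = map_pmf (\<lambda>l. (hd l, tl l)) Q"
    have lenP: "length l = Suc n" if "l \<in> set_pmf P" for l
      using A that set_pmf_not_empty[of Q] by blast
    have lenQ: "length l = Suc n" if "l \<in> set_pmf Q" for l
      using A that set_pmf_not_empty[of P] by blast
    have P_eq: "map_pmf (\<lambda>(x, xs). x # xs) P' = P"
    proof -
      have "map_pmf (\<lambda>(x, xs). x # xs) P' = map_pmf (\<lambda>l. l) P"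
        unfolding P'_def pmf.map_comp by (rule map_pmf_cong) (auto dest!: lenP simp: length_Suc_conv)
      then show ?thesis by simp
    qed
    have Q_eq: "map_pmf (\<lambda>(x, xs). x # xs) Q' = Q"
    proof -
      have "map_pmf (\<lambda>(x, xs). x # xs) Q' = map_pmf (\<lambda>l. l) Q"
        unfolding Q'_def pmf.map_comp by (rule map_pmf_cong) (auto dest!: lenQ simp: length_Suc_conv)
      then show ?thesis by simp
    qed
    have entP: "ent P' = ent P"
      unfolding P'_def
    proof (intro ent_map_inj inj_onI)
      fix k l assume "k \<in> set_pmf P" "l \<in> set_pmf P" and eq: "(hd k, tl k) = (hd l, tl l)"
      then have "k \<noteq> []" "l \<noteq> []" using lenP by fastforce+
      then show "k = l" using eq by (auto intro: list.expand)
    qed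
    have entQ: "ent Q' = ent Q"
      unfolding Q'_def
    proof (intro ent_map_inj inj_onI)
      fix k l assume "k \<in> set_pmf Q" "l \<in> set_pmf Q" and eq: "(hd k, tl k) = (hd l, tl l)"
      then have "k \<noteq> []" "l \<noteq> []" using lenQ by fastforce+
      then show "k = l" using eq by (auto intro: list.expand)
    qed
    have fin': "finite (set_pmf P')" "finite (set_pmf Q')"
      using finP finQ by (simp_all add: P'_def Q'_def)
    have AA: "\<forall>x\<in>set_pmf P'. \<forall>y\<in>set_pmf Q'. (case x of (x1, x2) \<Rightarrow> \<lambda>(y1, y2). A x1 y1 \<and>
        (length x2 = n \<and> length y2 = n \<and> (\<forall>i<n. A (x2 ! i) (y2 ! i)))) y"
    proof (clarsimp simp: P'_def Q'_def)
      fix xs ys assume "xs \<in> set_pmf P" "ys \<in> set_pmf Q"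
      then have *: "length xs = Suc n \<and> length ys = Suc n \<and> (\<forall>i<Suc n. A (xs ! i) (ys ! i))"
        using A by blast
      then obtain x xs' y ys' where "xs = x # xs'" "ys = y # ys'" by (meson length_Suc_conv)
      then show "A (hd xs) (hd ys) \<and> length xs - Suc 0 = n \<and> length ys - Suc 0 = n
          \<and> (\<forall>i<n. A (tl xs ! i) (tl ys ! i))"
        using * by (auto simp: less_Suc_eq_0_disj all_conj_distrib)
    qed
    then obtain R where R: "R \<in> couplings P' Q'"
      "ent P' + ent Q' + expect (pair_pmf P' Q')
        (\<lambda>((x1, x2), (y1, y2)). \<phi> (x1, y1) + (\<lambda>(xs, ys). \<Sum>i<n. \<phi> (xs ! i, ys ! i)) (x2, y2))
      \<le> expect R (\<lambda>((x1, x2), (y1, y2)). c (x1, y1) + (\<lambda>(xs, ys). \<Sum>i<n. c (xs ! i, ys ! i)) (x2, y2))"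
      using cb2[unfolded coupling_bound_def, THEN spec[of _ P'], THEN spec[of _ Q'],
        THEN mp, THEN mp, THEN mp, OF fin' AA] by blast
    define R' where "R' = map_pmf (\<lambda>((x, xs), (y, ys)). (x # xs, y # ys)) R"
    have "map_pmf fst R' = map_pmf (\<lambda>(x, xs). x # xs) (map_pmf fst R)"
      "map_pmf snd R' = map_pmf (\<lambda>(x, xs). x # xs) (map_pmf snd R)"
      by (simp_all add: R'_def pmf.map_comp o_def case_prod_unfold)
    then have R': "R' \<in> couplings P Q"
      using R(1) P_eq Q_eq by (simp add: couplings_def)
    have PQ: "pair_pmf P Q = map_pmf (\<lambda>((x, xs), (y, ys)). (x # xs, y # ys)) (pair_pmf P' Q')"
      using map_pair[of "\<lambda>(x, xs). x # xs" "\<lambda>(x, xs). x # xs" P' Q', unfolded P_eq Q_eq]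
      by (simp only: case_prod_unfold)
    have "ent P + ent Q + expect (pair_pmf P Q) (\<lambda>(xs, ys). \<Sum>i<Suc n. \<phi> (xs ! i, ys ! i))
       \<le> expect R' (\<lambda>(xs, ys). \<Sum>i<Suc n. c (xs ! i, ys ! i))"
      using R(2) unfolding PQ R'_def entP entQ sum.lessThan_Suc_shift
      by (simp add: case_prod_unfold)
    then show "\<exists>R\<in>couplings P Q. ent P + ent Q
       + expect (pair_pmf P Q) (\<lambda>(xs, ys). \<Sum>i<Suc n. \<phi> (xs ! i, ys ! i))
       \<le> expect R (\<lambda>(xs, ys). \<Sum>i<Suc n. c (xs ! i, ys ! i))"
      using R' by blast
  qed
qed

section \<open>Converse at a fixed block length: a lower bound for the entropy of W\<close>

lemma pmf_bind_ge: "pmf p x * pmf (f x) z \<le> pmf (bind_pmf p f) z"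
proof -
  have "ennreal (pmf p x * pmf (f x) z) = (\<integral>\<^sup>+ y. ennreal (pmf (f x) z) * indicator {x} y \<partial>measure_pmf p)"
    by (subst nn_integral_cmult_indicator)
      (simp_all add: emeasure_pmf_single ennreal_mult mult.commute)
  also have "\<dots> \<le> (\<integral>\<^sup>+ y. ennreal (pmf (f y) z) \<partial>measure_pmf p)"
    by (intro nn_integral_mono) (auto split: split_indicator)
  also have "\<dots> = ennreal (pmf (bind_pmf p f) z)"
    by (simp add: ennreal_pmf_bind)
  finally show ?thesis by (simp add: ennreal_le_iff)
qed

lemma shannon_entropy_eq:
  "shannon_entropy p = (\<integral>\<^sup>+ x. ennreal (- ln (pmf p x)) \<partial>measure_pmf p)"
  unfolding shannon_entropy_def nn_integral_measure_pmf
  by (intro nn_integral_cong) (simp add: ennreal_mult'[symmetric])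

text \<open>\<open>ennreal\<close> sends negative values to zero, so the right-hand side integrates
  the positive part. The lower bounds for \<open>- ln (pmf W w)\<close> to which this is applied may
  be negative.\<close>

lemma ennreal_integral_le_nn_integral:
  fixes f :: "'a \<Rightarrow> real"
  assumes "integrable M f"
  shows "ennreal (\<integral>x. f x \<partial>M) \<le> (\<integral>\<^sup>+ x. ennreal (f x) \<partial>M)"
proof -
  have "(\<integral>x. f x \<partial>M) \<le> enn2real (\<integral>\<^sup>+ x. ennreal (f x) \<partial>M)"
    by (subst real_lebesgue_integral_def[OF assms]) simp
  then have "ennreal (\<integral>x. f x \<partial>M) \<le> ennreal (enn2real (\<integral>\<^sup>+ x. ennreal (f x) \<partial>M))"
    by (rule ennreal_leI)
  also have "\<dots> \<le> (\<integral>\<^sup>+ x. ennreal (f x) \<partial>M)"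
    by (cases "(\<integral>\<^sup>+ x. ennreal (f x) \<partial>M)") auto
  finally show ?thesis .
qed

lemma expect_iid_pair_sum:
  fixes p :: "('a::finite \<times> 'b::finite) pmf"
  shows "expect (iid_pair n p) (\<lambda>(xs, ys). \<Sum>i<n. f (xs ! i, ys ! i)) = real n * expect p f"
proof -
  have "expect (replicate_pmf n p) (\<lambda>zs. \<Sum>i<n. f (zs ! i)) = real n * expect p f" for n
  proof (induction n)
    case (Suc n)
    have fin: "finite (set_pmf (replicate_pmf n p))"
      by (simp add: set_replicate_pmf lists_eq_set finite_lists_length_eq)
    have "expect (replicate_pmf (Suc n) p) (\<lambda>zs. \<Sum>i<Suc n. f (zs ! i))
        = expect p (\<lambda>x. expect (replicate_pmf n p) (\<lambda>zs. f x + (\<Sum>i<n. f (zs ! i))))"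
      using fin by (simp add: expect_bind_finite sum.lessThan_Suc_shift del: sum.lessThan_Suc)
    also have "\<dots> = expect p f + real n * expect p f"
      by (simp add: expect_add_finite[OF fin] Suc.IH expect_add_finite)
    finally show ?case by (simp add: algebra_simps)
  qed simp
  moreover have "expect (iid_pair n p) (\<lambda>(xs, ys). \<Sum>i<n. f (xs ! i, ys ! i))
      = expect (replicate_pmf n p) (\<lambda>zs. \<Sum>i<n. f (zs ! i))"
    unfolding iid_pair_def
    by simp (intro expect_cong_pmf sum.cong, auto simp: set_replicate_pmf)
  ultimately show ?thesis by simp
qed

lemma set_iid_pairD:
  assumes "(xs, ys) \<in> set_pmf (iid_pair n p)"
  shows "length xs = n" "length ys = n" "\<And>i. i < n \<Longrightarrow> (xs ! i, ys ! i) \<in> set_pmf p"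
    using assms by (auto simp: iid_pair_def set_replicate_pmf in_lists_conv_set)

lemma finite_set_iid_pair:
  fixes p :: "('a::finite \<times> 'b::finite) pmf"
  shows "finite (set_pmf (iid_pair n p))"
  by (simp add: iid_pair_def set_replicate_pmf lists_eq_set finite_lists_length_eq)

lemma set_markov_decomposition:
  assumes "markov_decomposition p W P Q" "w \<in> set_pmf W"
  shows "set_pmf (P w) \<times> set_pmf (Q w) \<subseteq> set_pmf p"
  using assms unfolding markov_decomposition_def by auto

lemma finite_markov_decomposition:
  assumes "markov_decomposition p W P Q" "w \<in> set_pmf W" "finite (set_pmf p)"
  shows "finite (set_pmf (P w))" "finite (set_pmf (Q w))"
proof -
  have "finite (set_pmf (P w) \<times> set_pmf (Q w))"
    using set_markov_decomposition[OF assms(1,2)] assms(3) finite_subset by blast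
  then show "finite (set_pmf (P w))" "finite (set_pmf (Q w))"
    using set_pmf_not_empty by (metis finite_cartesian_productD1, metis finite_cartesian_productD2)
qed

text \<open>One value \<open>w\<close> is treated at a time: the bound for \<open>n\<close> letters,
  applied to its two kernels, is compared with \<open>- ln (pmf W w)\<close>. Averaging over
  \<open>W\<close> then mixes the product laws back to \<open>iid_pair n \<pi>\<close>. The support
  of \<open>W\<close> may be infinite, and so may its entropy.\<close>

lemma entropy_ge_of_coupling_bound:
  fixes \<pi> :: "('a::finite \<times> 'b::finite) pmf" and W :: "'w pmf"
  assumes cb: "coupling_bound (\<lambda>x y. (x, y) \<in> set_pmf \<pi>) (\<lambda>z. - ln (pmf \<pi> z)) \<phi>"
    and md: "markov_decomposition (iid_pair n \<pi>) W P Q"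
  shows "ennreal (real n * expect \<pi> \<phi>) \<le> shannon_entropy W"
proof -
  let ?p = "iid_pair n \<pi>"
  let ?S = "set_pmf ?p"
  define \<phi>n where "\<phi>n = (\<lambda>(xs, ys). \<Sum>i<n. \<phi> (xs ! i, ys ! i))"
  have finS: "finite ?S" by (rule finite_set_iid_pair)
  have sub: "set_pmf (P w) \<times> set_pmf (Q w) \<subseteq> ?S" if "w \<in> set_pmf W" for w
    by (rule set_markov_decomposition[OF md that])
  have main: "expect (pair_pmf (P w) (Q w)) \<phi>n \<le> - ln (pmf W w)" if w: "w \<in> set_pmf W" for w
  proof -
    note fin = finite_markov_decomposition[OF md w finS]
    have "\<forall>x\<in>set_pmf (P w). \<forall>y\<in>set_pmf (Q w). length x = n \<and> length y = n
        \<and> (\<forall>i<n. (x ! i, y ! i) \<in> set_pmf \<pi>)"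
    proof (intro ballI)
      fix x y assume "x \<in> set_pmf (P w)" "y \<in> set_pmf (Q w)"
      then have "(x, y) \<in> ?S" using sub[OF w] by blast
      from set_iid_pairD[OF this] show "length x = n \<and> length y = n
        \<and> (\<forall>i<n. (x ! i, y ! i) \<in> set_pmf \<pi>)" by blast
    qed
    then obtain R where R: "R \<in> couplings (P w) (Q w)"
      "ent (P w) + ent (Q w) + expect (pair_pmf (P w) (Q w)) \<phi>n
        \<le> expect R (\<lambda>(xs, ys). \<Sum>i<n. - ln (pmf \<pi> (xs ! i, ys ! i)))"
      using coupling_bound_lists[OF cb, of n] fin unfolding coupling_bound_def \<phi>n_def by blast
    have finR: "finite (set_pmf R)" by (rule finite_coupling[OF R(1) fin])
    have marg: "map_pmf fst R = P w" "map_pmf snd R = Q w"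
      using R(1) by (auto simp: couplings_def)
    \<comment> \<open>One term of the mixture is at most the whole. After taking logarithms, the
      kernel terms depend on one coordinate each, so under any coupling they average to the
      entropies of the kernels.\<close>
    have "expect R (\<lambda>(xs, ys). \<Sum>i<n. - ln (pmf \<pi> (xs ! i, ys ! i)))
        \<le> expect R (\<lambda>z. - ln (pmf W w) + (- ln (pmf (P w) (fst z)) + - ln (pmf (Q w) (snd z))))"
    proof (rule expect_mono_finite[OF finR])
      fix z assume "z \<in> set_pmf R"
      moreover obtain xs ys where z: "z = (xs, ys)" by fastforce
      ultimately have xy: "xs \<in> set_pmf (P w)" "ys \<in> set_pmf (Q w)"
        using set_pmf_coupling[OF R(1)] by auto
      then have S: "(xs, ys) \<in> ?S" using sub[OF w] by blast
      have pos: "pmf \<pi> (xs ! i, ys ! i) > 0" if "i < n" for i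
        using set_iid_pairD(3)[OF S that] by (rule pmf_positive)
      have "pmf W w * (pmf (P w) xs * pmf (Q w) ys) \<le> pmf ?p (xs, ys)"
        using pmf_bind_ge[of W w "\<lambda>w. pair_pmf (P w) (Q w)" "(xs, ys)"] md
        by (simp add: pmf_pair markov_decomposition_def)
      moreover have "0 < pmf W w * (pmf (P w) xs * pmf (Q w) ys)"
        using w xy by (simp add: pmf_positive)
      ultimately have "ln (pmf W w * (pmf (P w) xs * pmf (Q w) ys)) \<le> ln (pmf ?p (xs, ys))"
        by (subst ln_le_cancel_iff) auto
      also have "ln (pmf ?p (xs, ys)) = (\<Sum>i<n. ln (pmf \<pi> (xs ! i, ys ! i)))"
        unfolding pmf_iid_pair[OF set_iid_pairD(1,2)[OF S]]
        by (rule ln_prod) (use pos in force)+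
      also have "ln (pmf W w * (pmf (P w) xs * pmf (Q w) ys))
          = ln (pmf W w) + (ln (pmf (P w) xs) + ln (pmf (Q w) ys))"
        using pmf_positive[OF w] pmf_positive[OF xy(1)] pmf_positive[OF xy(2)]
        by (simp add: ln_mult)
      finally show "(case z of (xs, ys) \<Rightarrow> \<Sum>i<n. - ln (pmf \<pi> (xs ! i, ys ! i)))
          \<le> - ln (pmf W w) + (- ln (pmf (P w) (fst z)) + - ln (pmf (Q w) (snd z)))"
        by (simp add: sum_negf z)
    qed
    also have "\<dots> = - ln (pmf W w) + (ent (P w) + ent (Q w))"
    proof -
      have "expect R (\<lambda>z. - ln (pmf (P w) (fst z))) = expect (map_pmf fst R) (\<lambda>x. - ln (pmf (P w) x))"
        "expect R (\<lambda>z. - ln (pmf (Q w) (snd z))) = expect (map_pmf snd R) (\<lambda>x. - ln (pmf (Q w) x))"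
        by (simp_all only: integral_map_pmf)
      then show ?thesis unfolding expect_add_finite[OF finR] marg ent_def by simp
    qed
    finally show ?thesis using R(2) by linarith
  qed
  \<comment> \<open>As a finite sum over the support of \<open>?p\<close>, the average of
    \<open>\<phi>n\<close> is a bounded function of \<open>w\<close>, hence integrable even if
    \<open>W\<close> has infinite support.\<close>
  let ?g = "\<lambda>w. \<Sum>z\<in>?S. \<phi>n z * pmf (pair_pmf (P w) (Q w)) z"
  have int: "integrable (measure_pmf W) (\<lambda>w. pmf (pair_pmf (P w) (Q w)) z)" for z
    by (intro measure_pmf.integrable_const_bound[where B = 1]) (auto simp: pmf_le_1)
  have "real n * expect \<pi> \<phi> = expect ?p \<phi>n"
    by (simp add: expect_iid_pair_sum \<phi>n_def)
  also have "\<dots> = (\<Sum>z\<in>?S. \<phi>n z * pmf ?p z)"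
    using finS by (intro integral_measure_pmf_real) auto
  also have "\<dots> = (\<Sum>z\<in>?S. \<phi>n z * expect W (\<lambda>w. pmf (pair_pmf (P w) (Q w)) z))"
    using md by (simp only: markov_decomposition_def pmf_bind[symmetric])
  also have "\<dots> = expect W ?g"
    using int by (subst Bochner_Integration.integral_sum) auto
  finally have eq: "real n * expect \<pi> \<phi> = expect W ?g" .
  have "ennreal (expect W ?g) \<le> (\<integral>\<^sup>+ w. ennreal (?g w) \<partial>measure_pmf W)"
    using int by (intro ennreal_integral_le_nn_integral) auto
  also have "\<dots> \<le> (\<integral>\<^sup>+ w. ennreal (- ln (pmf W w)) \<partial>measure_pmf W)"
  proof (intro nn_integral_mono_AE, unfold AE_measure_pmf_iff, intro ballI ennreal_leI)
    fix w assume w: "w \<in> set_pmf W"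
    have "?g w = expect (pair_pmf (P w) (Q w)) \<phi>n"
      using finS sub[OF w] by (intro integral_measure_pmf_real[symmetric]) auto
    then show "?g w \<le> - ln (pmf W w)" using main[OF w] by simp
  qed
  finally show ?thesis unfolding eq shannon_entropy_eq .
qed

lemma ent_nonneg: "finite (set_pmf p) \<Longrightarrow> ent p \<ge> 0"
  using expect_mono_finite[of p "\<lambda>_. 0" "\<lambda>x. - ln (pmf p x)"]
  by (simp add: ent_def pmf_positive pmf_le_1)

lemma shannon_entropy_eq_ent:
  assumes "finite (set_pmf p)"
  shows "shannon_entropy p = ennreal (ent p)"
  unfolding shannon_entropy_eq ent_def
  by (intro nn_integral_eq_integral integrable_measure_pmf_finite assms)
     (auto simp: AE_measure_pmf_iff pmf_positive pmf_le_1)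

lemma pair_in_couplings: "pair_pmf P Q \<in> couplings P Q"
  by (simp add: couplings_def map_fst_pair_pmf map_snd_pair_pmf)

section \<open>Convex duality\<close>

lemma nn_integral_log_cost:
  fixes \<pi> :: "('a::finite \<times> 'b::finite) pmf"
  assumes "set_pmf R \<subseteq> set_pmf \<pi>"
  shows "(\<integral>\<^sup>+ (x, y). log_cost \<pi> x y \<partial>measure_pmf R) = ennreal (expect R (\<lambda>z. - ln (pmf \<pi> z)))"
proof -
  have "(\<integral>\<^sup>+ (x, y). log_cost \<pi> x y \<partial>measure_pmf R)
      = (\<integral>\<^sup>+ z. ennreal (- ln (pmf \<pi> z)) \<partial>measure_pmf R)"
    using assms
    by (intro nn_integral_cong_AE)
       (auto simp: AE_measure_pmf_iff log_cost_def set_pmf_iff ln_div subset_iff)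
  also have "\<dots> = ennreal (expect R (\<lambda>z. - ln (pmf \<pi> z)))"
    using assms
    by (intro nn_integral_eq_integral integrable_measure_pmf_finite)
       (auto simp: AE_measure_pmf_iff pmf_le_1 pmf_positive subset_iff)
  finally show ?thesis .
qed

text \<open>Meaningful when the supports of \<open>P\<close> and \<open>Q\<close> span a rectangle
  inside the support of \<open>\<pi>\<close>. Otherwise the product coupling has infinite cost and
  the value is the default 0.\<close>

definition transport :: "('a::finite \<times> 'b::finite) pmf \<Rightarrow> 'a pmf \<Rightarrow> 'b pmf \<Rightarrow> real" where
  "transport \<pi> P Q = enn2real (max_transport (log_cost \<pi>) P Q)"

text \<open>A sum of nonnegative costs, used as a convenient upper bound for each of them.\<close>

definition max_log_cost :: "('a::finite \<times> 'b::finite) pmf \<Rightarrow> real" where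
  "max_log_cost \<pi> = (\<Sum>z\<in>set_pmf \<pi>. - ln (pmf \<pi> z))"

lemma log_cost_bounds:
  fixes \<pi> :: "('a::finite \<times> 'b::finite) pmf"
  assumes "z \<in> set_pmf \<pi>"
  shows "0 \<le> - ln (pmf \<pi> z)" "- ln (pmf \<pi> z) \<le> max_log_cost \<pi>"
proof -
  have nn: "0 \<le> - ln (pmf \<pi> z)" if "z \<in> set_pmf \<pi>" for z
    using that by (simp add: pmf_le_1 pmf_positive)
  then show "0 \<le> - ln (pmf \<pi> z)" using assms by blast
  show "- ln (pmf \<pi> z) \<le> max_log_cost \<pi>"
    unfolding max_log_cost_def using assms nn by (intro member_le_sum) auto
qed

lemma max_log_cost_nonneg: "0 \<le> max_log_cost \<pi>"
  using log_cost_bounds set_pmf_not_empty by (metis all_not_in_conv order_trans)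

context
  fixes \<pi> :: "('a::finite \<times> 'b::finite) pmf" and P :: "'a pmf" and Q :: "'b pmf"
  assumes supp: "set_pmf P \<times> set_pmf Q \<subseteq> set_pmf \<pi>"
begin

lemma max_transport_eq:
  "max_transport (log_cost \<pi>) P Q = (SUP R\<in>couplings P Q. ennreal (expect R (\<lambda>z. - ln (pmf \<pi> z))))"
  unfolding max_transport_def
  using supp set_pmf_coupling by (intro SUP_cong refl nn_integral_log_cost) blast

lemma expect_log_cost_le:
  assumes "R \<in> couplings P Q"
  shows "expect R (\<lambda>z. - ln (pmf \<pi> z)) \<le> max_log_cost \<pi>"
proof -
  have "expect R (\<lambda>z. - ln (pmf \<pi> z)) \<le> expect R (\<lambda>_. max_log_cost \<pi>)"
  proof (rule expect_mono_finite)
    fix z assume "z \<in> set_pmf R"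
    then have "z \<in> set_pmf \<pi>" using supp set_pmf_coupling[OF assms] by blast
    then show "- ln (pmf \<pi> z) \<le> max_log_cost \<pi>" by (rule log_cost_bounds(2))
  qed simp
  then show ?thesis by simp
qed

lemma max_transport_le: "max_transport (log_cost \<pi>) P Q \<le> ennreal (max_log_cost \<pi>)"
  unfolding max_transport_eq by (intro SUP_least ennreal_leI expect_log_cost_le)

lemma max_transport_eq_transport: "max_transport (log_cost \<pi>) P Q = ennreal (transport \<pi> P Q)"
  unfolding transport_def using max_transport_le
  by (metis ennreal_enn2real_if ennreal_less_top not_le)

lemma transport_nonneg: "0 \<le> transport \<pi> P Q"
  by (simp add: transport_def)

lemma transport_le: "transport \<pi> P Q \<le> max_log_cost \<pi>"
  using max_transport_le unfolding max_transport_eq_transport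
  by (simp add: ennreal_le_iff max_log_cost_nonneg)

lemma expect_le_transport:
  assumes "R \<in> couplings P Q"
  shows "expect R (\<lambda>z. - ln (pmf \<pi> z)) \<le> transport \<pi> P Q"
proof -
  have "ennreal (expect R (\<lambda>z. - ln (pmf \<pi> z))) \<le> ennreal (transport \<pi> P Q)"
    unfolding max_transport_eq_transport[symmetric] max_transport_eq
    using assms by (intro SUP_upper)
  then show ?thesis using transport_nonneg by (simp add: ennreal_le_iff)
qed

text \<open>An almost optimal coupling is enough, so the supremum need not be shown to be attained.
  For negative \<open>v\<close> the product coupling serves, its cost being nonnegative.\<close>

lemma less_transport:
  assumes "v < transport \<pi> P Q"
  obtains R where "R \<in> couplings P Q" "v \<le> expect R (\<lambda>z. - ln (pmf \<pi> z))"
proof (cases "0 \<le> v")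
  case True
  then have "ennreal v < max_transport (log_cost \<pi>) P Q"
    unfolding max_transport_eq_transport using assms by (intro ennreal_lessI) auto
  then obtain R where "R \<in> couplings P Q" "ennreal v < ennreal (expect R (\<lambda>z. - ln (pmf \<pi> z)))"
    unfolding max_transport_eq less_SUP_iff by blast
  then show thesis using True that by (metis ennreal_less_iff less_imp_le)
next
  case False
  have "set_pmf (pair_pmf P Q) \<subseteq> set_pmf \<pi>" using supp by simp
  then have "0 \<le> expect (pair_pmf P Q) (\<lambda>z. - ln (pmf \<pi> z))"
    using log_cost_bounds(1) by (intro integral_nonneg_AE) (auto simp: AE_measure_pmf_iff)
  then show thesis using False that[OF pair_in_couplings] by simp
qed

lemma Phi_eq: "Phi (log_cost \<pi>) P Q = ereal (transport \<pi> P Q - ent P - ent Q)"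
  unfolding Phi_def max_transport_eq_transport
  by (simp add: shannon_entropy_eq_ent transport_nonneg ent_nonneg)

end

text \<open>\<open>Gamma_functional \<pi>\<close> is the value at \<open>\<pi>\<close> of the lower
  convex envelope of \<open>\<Phi>\<close> over product laws. A point strictly below the envelope is
  separated from the convexified epigraph by a hyperplane; solved for the height, it is an affine
  function of the law, that is, the expectation of some \<open>\<phi>\<close>.\<close>

lemma dual_certificate:
  fixes \<pi> :: "('a::finite \<times> 'b::finite) pmf"
  assumes less: "ereal g < Gamma_functional \<pi>"
  obtains \<phi> where "coupling_bound (\<lambda>x y. (x, y) \<in> set_pmf \<pi>) (\<lambda>z. - ln (pmf \<pi> z)) \<phi>"
    "g \<le> expect \<pi> \<phi>"
proof -
  let ?C = "max_log_cost \<pi>"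
  define vec :: "('a \<times> 'b) pmf \<Rightarrow> real ^ ('a \<times> 'b)" where "vec \<theta> = (\<chi> z. pmf \<theta> z)" for \<theta>
  \<comment> \<open>The epigraph of \<open>\<Phi>\<close> over the product laws carried by the
    support of \<open>\<pi>\<close>, where \<open>\<Phi>\<close> is finite.\<close>
  define S where "S = {(vec (pair_pmf P Q), v) | P Q v.
    set_pmf P \<times> set_pmf Q \<subseteq> set_pmf \<pi> \<and> transport \<pi> P Q - ent P - ent Q \<le> v}"
  define K where "K = convex hull S"
  \<comment> \<open>The weights of a convex combination that reaches \<open>\<pi>\<close> are the
    law of a \<open>W\<close> on \<open>{1..k}\<close>, and the points combined supply its
    kernels.\<close>
  have K_Gamma: "Gamma_functional \<pi> \<le> ereal v" if "(vec \<pi>, v) \<in> K" for v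
  proof -
    have "\<exists>k u x. (\<forall>i\<in>{1::nat..k}. 0 \<le> u i \<and> x i \<in> S) \<and> sum u {1..k} = 1
        \<and> (\<Sum>i = 1..k. u i *\<^sub>R x i) = (vec \<pi>, v)"
      using that unfolding K_def convex_hull_indexed mem_Collect_eq .
    then obtain k :: nat and u x where ux: "\<forall>i\<in>{1..k}. 0 \<le> u i \<and> x i \<in> S"
      and u_sum: "sum u {1..k} = 1" and u_pt: "(\<Sum>i = 1..k. u i *\<^sub>R x i) = (vec \<pi>, v)"
      by (elim exE conjE)
    then have u: "\<And>i. i \<in> {1..k} \<Longrightarrow> 0 \<le> u i" "\<And>i. i \<in> {1..k} \<Longrightarrow> x i \<in> S" by blast+
    have "\<forall>i\<in>{1..k}. \<exists>P Q v. x i = (vec (pair_pmf P Q), v) \<and> set_pmf P \<times> set_pmf Q \<subseteq> set_pmf \<pi>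
        \<and> transport \<pi> P Q - ent P - ent Q \<le> v"
      using u(2) unfolding S_def by blast
    then obtain P Q t where PQ: "\<And>i. i \<in> {1..k} \<Longrightarrow> x i = (vec (pair_pmf (P i) (Q i)), t i)"
      "\<And>i. i \<in> {1..k} \<Longrightarrow> set_pmf (P i) \<times> set_pmf (Q i) \<subseteq> set_pmf \<pi>"
      "\<And>i. i \<in> {1..k} \<Longrightarrow> transport \<pi> (P i) (Q i) - ent (P i) - ent (Q i) \<le> t i"
      by metis
    define W where "W = embed_pmf (\<lambda>i. if i \<in> {1..k} then u i else 0)"
    have pmfW: "pmf W i = (if i \<in> {1..k} then u i else 0)" for i
      unfolding W_def
    proof (rule pmf_embed_pmf)
      have "(\<integral>\<^sup>+ i. ennreal (if i \<in> {1..k} then u i else 0) \<partial>count_space UNIV)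
          = (\<Sum>i\<in>{1..k}. ennreal (if i \<in> {1..k} then u i else 0))"
        by (rule nn_integral_count_space') auto
      also have "\<dots> = ennreal (sum u {1..k})"
        using u(1) by (subst sum_ennreal[symmetric]) (auto intro!: sum.cong)
      finally show "(\<integral>\<^sup>+ i. ennreal (if i \<in> {1..k} then u i else 0) \<partial>count_space UNIV) = 1"
        using u_sum by simp
    qed (use u(1) in auto)
    have setW: "set_pmf W \<subseteq> {1..k}"
      by (auto simp: set_pmf_iff pmfW split: if_splits)
    have "bind_pmf W (\<lambda>i. pair_pmf (P i) (Q i)) = \<pi>"
    proof (rule pmf_eqI)
      fix z
      have "pmf (bind_pmf W (\<lambda>i. pair_pmf (P i) (Q i))) z
          = (\<Sum>i = 1..k. pmf (pair_pmf (P i) (Q i)) z * pmf W i)"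
        unfolding pmf_bind using setW by (intro integral_measure_pmf_real) auto
      also have "\<dots> = (\<Sum>i = 1..k. u i * pmf (pair_pmf (P i) (Q i)) z)"
        by (intro sum.cong) (auto simp: pmfW)
      also have "\<dots> = fst (\<Sum>i = 1..k. u i *\<^sub>R x i) $ z"
        by (simp add: fst_sum PQ(1) vec_def)
      finally show "pmf (bind_pmf W (\<lambda>i. pair_pmf (P i) (Q i))) z = pmf \<pi> z"
        unfolding u_pt by (simp add: vec_def)
    qed
    then have md: "markov_decomposition \<pi> W P Q" by (simp add: markov_decomposition_def)
    have "Gamma_functional \<pi> \<le> (\<Sum>w\<in>set_pmf W. ereal (pmf W w) * Phi (log_cost \<pi>) (P w) (Q w))"
      unfolding Gamma_functional_def using md finite_subset[OF setW]
      by (intro INF_lower2[of "(W, P, Q)"]) auto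
    also have "\<dots> = (\<Sum>w\<in>set_pmf W. ereal (pmf W w * (transport \<pi> (P w) (Q w) - ent (P w) - ent (Q w))))"
      using PQ(2) setW by (intro sum.cong) (auto simp: Phi_eq)
    also have "\<dots> = ereal (\<Sum>w\<in>set_pmf W. pmf W w * (transport \<pi> (P w) (Q w) - ent (P w) - ent (Q w)))"
      by simp
    also have "\<dots> \<le> ereal (\<Sum>w\<in>set_pmf W. pmf W w * t w)"
      unfolding ereal_less_eq(3) using PQ(3) setW by (intro sum_mono mult_left_mono) auto
    also have "(\<Sum>w\<in>set_pmf W. pmf W w * t w) = (\<Sum>w=1..k. u w * t w)"
      using setW by (intro sum.mono_neutral_cong_left) (auto simp: set_pmf_iff pmfW)
    also have "\<dots> = snd (\<Sum>i = 1..k. u i *\<^sub>R x i)"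
      by (simp add: snd_sum PQ(1))
    finally show ?thesis unfolding u_pt by simp
  qed
  \<comment> \<open>Point masses are product laws. Mixing them puts every law carried by the support
    of \<open>\<pi>\<close> into \<open>K\<close> at the height \<open>?C\<close>.\<close>
  have point: "(vec (pair_pmf (return_pmf x) (return_pmf y)), ?C) \<in> K" if "(x, y) \<in> set_pmf \<pi>" for x y
  proof -
    have supp: "set_pmf (return_pmf x) \<times> set_pmf (return_pmf y) \<subseteq> set_pmf \<pi>" using that by simp
    have "transport \<pi> (return_pmf x) (return_pmf y) - ent (return_pmf x) - ent (return_pmf y) \<le> ?C"
      using transport_le[OF supp] ent_nonneg[of "return_pmf x"] ent_nonneg[of "return_pmf y"] by simp
    then have "(vec (pair_pmf (return_pmf x) (return_pmf y)), ?C) \<in> S"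
      unfolding S_def using supp by blast
    then show ?thesis unfolding K_def by (rule hull_inc)
  qed
  have K_top: "(\<rho>, ?C) \<in> K"
    if \<rho>: "\<And>z. 0 \<le> \<rho> $ z" "(\<Sum>z\<in>UNIV. \<rho> $ z) = 1" "\<And>z. z \<notin> set_pmf \<pi> \<Longrightarrow> \<rho> $ z = 0" for \<rho>
  proof -
    have sum1: "(\<Sum>z\<in>set_pmf \<pi>. \<rho> $ z) = 1"
      unfolding \<rho>(2)[symmetric] using \<rho>(3) by (intro sum.mono_neutral_left) auto
    have "(\<Sum>z\<in>set_pmf \<pi>. \<rho> $ z *\<^sub>R (vec (pair_pmf (return_pmf (fst z)) (return_pmf (snd z))), ?C)) \<in> K"
      unfolding K_def using \<rho>(1) sum1 point
      by (intro convex_sum convex_convex_hull) (auto simp: K_def)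
    also have "(\<Sum>z\<in>set_pmf \<pi>. \<rho> $ z *\<^sub>R (vec (pair_pmf (return_pmf (fst z)) (return_pmf (snd z))), ?C)) = (\<rho>, ?C)"
    proof -
      have "(\<Sum>z\<in>set_pmf \<pi>. \<rho> $ z * indicator {z} z') = \<rho> $ z'" for z'
        using \<rho>(3)[of z'] by (cases "z' \<in> set_pmf \<pi>") (simp_all add: indicator_def if_distrib cong: if_cong)
      moreover have "vec (pair_pmf (return_pmf (fst z)) (return_pmf (snd z))) $ z' = indicator {z} z'" for z z'
        by (auto simp: vec_def pair_pmf_def bind_return_pmf pmf_return split: split_indicator)
      ultimately have "(\<Sum>z\<in>set_pmf \<pi>. \<rho> $ z *\<^sub>R vec (pair_pmf (return_pmf (fst z)) (return_pmf (snd z)))) = \<rho>"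
        by (simp add: vec_eq_iff)
      moreover have "(\<Sum>z\<in>set_pmf \<pi>. \<rho> $ z *\<^sub>R ?C) = ?C"
        using sum1 by (simp flip: sum_distrib_right)
      ultimately show ?thesis by (simp add: prod_eq_iff fst_sum snd_sum)
    qed
    finally show ?thesis .
  qed
  have K_prob: "(\<forall>z. 0 \<le> fst p $ z) \<and> (\<Sum>z\<in>UNIV. fst p $ z) = 1 \<and> (\<forall>z. z \<notin> set_pmf \<pi> \<longrightarrow> fst p $ z = 0)"
    if "p \<in> K" for p
  proof -
    let ?T = "{p :: (real ^ ('a \<times> 'b)) \<times> real. (\<forall>z. 0 \<le> fst p $ z) \<and> (\<Sum>z\<in>UNIV. fst p $ z) = 1
      \<and> (\<forall>z. z \<notin> set_pmf \<pi> \<longrightarrow> fst p $ z = 0)}"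
    have "convex ?T"
      by (auto simp: convex_def sum.distrib sum_distrib_left[symmetric])
    moreover have "S \<subseteq> ?T"
      by (auto simp: S_def vec_def sum_pmf_eq_1 set_pmf_iff pmf_pair subset_iff) blast
    ultimately have "K \<subseteq> ?T" unfolding K_def by (rule hull_minimal[rotated])
    then show ?thesis using that by blast
  qed
  have vec_\<pi>: "(vec \<pi>, ?C) \<in> K"
    by (rule K_top) (auto simp: vec_def sum_pmf_eq_1 set_pmf_iff)
  have "ereal g < ereal ?C" using less K_Gamma[OF vec_\<pi>] by (rule less_le_trans)
  then have gC: "g < ?C" by simp
  obtain g' where g': "ereal g < ereal g'" "ereal g' < Gamma_functional \<pi>"
    using ereal_dense2[OF less] by blast
  have "(vec \<pi>, g) \<notin> closure K"
    \<comment> \<open>A distribution \<open>\<theta>\<close> near \<open>\<pi>\<close> and supported where \<open>\<pi>\<close> is, is completed to \<open>\<pi>\<close> by a small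
      multiple of some \<open>\<rho>\<close>, which raises the value by little.\<close>
  proof
    assume cl: "(vec \<pi>, g) \<in> closure K"
    define m where "m = Min (pmf \<pi> ` set_pmf \<pi>)"
    have m: "0 < m" "\<And>z. z \<in> set_pmf \<pi> \<Longrightarrow> m \<le> pmf \<pi> z"
      unfolding m_def by (auto simp: set_pmf_not_empty pmf_positive)
    \<comment> \<open>Mixing in weight \<open>\<eta>\<close> at height \<open>?C\<close> raises the
      value above \<open>g\<close> by at most \<open>\<eta> * (1 + \<bar>g\<bar> + ?C)\<close>; this
      choice keeps the result below \<open>g'\<close>.\<close>
    define \<eta> where "\<eta> = min (1/2) ((g' - g) / (2 * (1 + \<bar>g\<bar> + ?C)))"
    have D: "1 + \<bar>g\<bar> + ?C > 0" using max_log_cost_nonneg[of \<pi>] by linarith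
    have "0 < (g' - g) / (2 * (1 + \<bar>g\<bar> + ?C))"
      using g'(1) D by (intro divide_pos_pos) auto
    then have \<eta>: "0 < \<eta>" "\<eta> \<le> 1/2"
      unfolding \<eta>_def by (simp, intro min.cobounded1)
    have "\<eta> * (1 + \<bar>g\<bar> + ?C) \<le> (g' - g) / (2 * (1 + \<bar>g\<bar> + ?C)) * (1 + \<bar>g\<bar> + ?C)"
      unfolding \<eta>_def using D by (intro mult_right_mono min.cobounded2) auto
    also have "\<dots> = (g' - g) / 2" using D by (simp add: field_simps)
    finally have \<eta>3: "\<eta> * (1 + \<bar>g\<bar> + ?C) < g' - g" using g'(1) by simp
    have m1: "m \<le> 1" using m(2) set_pmf_not_empty pmf_le_1 by (metis all_not_in_conv order_trans)
    obtain p where p: "p \<in> K" "dist p (vec \<pi>, g) < \<eta> * m"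
      using cl \<eta>(1) m(1) unfolding closure_approachable by (meson mult_pos_pos)
    obtain \<theta> v where p_eq: "p = (\<theta>, v)" by fastforce
    have d1: "dist \<theta> (vec \<pi>) < \<eta> * m" using p(2) dist_fst_le[of p "(vec \<pi>, g)"] by (simp add: p_eq)
    have d2: "\<bar>v - g\<bar> < \<eta> * m"
      using p(2) dist_snd_le[of p "(vec \<pi>, g)"] by (simp add: p_eq dist_real_def)
    have comp: "\<bar>\<theta> $ z - pmf \<pi> z\<bar> < \<eta> * m" for z
      using d1 component_le_norm_cart[of "\<theta> - vec \<pi>" z] by (simp add: dist_norm vec_def)
    \<comment> \<open>The solution of \<open>(1 - \<eta>) \<theta> + \<eta> \<rho> = \<pi>\<close>.
      It is nonnegative because \<open>\<theta>\<close> exceeds \<open>\<pi>\<close> by less than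
      \<open>\<eta> * m\<close>, and \<open>m\<close> is the least positive probability of
      \<open>\<pi>\<close>.\<close>
    define \<rho> where "\<rho> = (\<chi> z. (pmf \<pi> z - (1 - \<eta>) * \<theta> $ z) / \<eta>)"
    note \<theta> = K_prob[OF p(1), unfolded p_eq fst_conv]
    have \<theta>_supp: "\<theta> $ z = 0" if "pmf \<pi> z = 0" for z
      using \<theta> that by (simp only: set_pmf_iff)
    have \<theta>_sum: "(\<Sum>z\<in>UNIV. \<theta> $ z) = 1" using \<theta> by blast
    have "(\<rho>, ?C) \<in> K"
    proof (rule K_top)
      show "0 \<le> \<rho> $ z" for z
      proof (cases "z \<in> set_pmf \<pi>")
        case True
        have "(1 - \<eta>) * \<theta> $ z \<le> (1 - \<eta>) * (pmf \<pi> z + \<eta> * m)"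
          using comp[of z] \<eta> by (intro mult_left_mono) auto
        also have "\<dots> = pmf \<pi> z - \<eta> * (pmf \<pi> z - m) - \<eta> * (\<eta> * m)"
          by (simp add: algebra_simps)
        also have "\<dots> \<le> pmf \<pi> z"
        proof -
          have "0 \<le> \<eta> * (pmf \<pi> z - m)" "0 \<le> \<eta> * (\<eta> * m)"
            using m(2)[OF True] m(1) \<eta>(1) by simp_all
          then show ?thesis by linarith
        qed
        finally show ?thesis using \<eta>(1) by (simp add: \<rho>_def)
      next
        case False
        then show ?thesis using \<theta>_supp by (simp add: \<rho>_def set_pmf_iff)
      qed
      have "(\<Sum>z\<in>UNIV. \<rho> $ z) = ((\<Sum>z\<in>UNIV. pmf \<pi> z) - (1 - \<eta>) * (\<Sum>z\<in>UNIV. \<theta> $ z)) / \<eta>"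
        by (simp add: \<rho>_def sum_divide_distrib[symmetric] sum_subtractf sum_distrib_left)
      also have "\<dots> = 1" using \<theta>_sum \<eta> by (simp add: sum_pmf_eq_1)
      finally show "(\<Sum>z\<in>UNIV. \<rho> $ z) = 1" .
      show "\<rho> $ z = 0" if "z \<notin> set_pmf \<pi>" for z
        using that \<theta>_supp by (simp add: \<rho>_def set_pmf_iff)
    qed
    then have "(1 - \<eta>) *\<^sub>R (\<theta>, v) + \<eta> *\<^sub>R (\<rho>, ?C) \<in> K"
      using p(1) \<eta> unfolding p_eq K_def by (intro convexD convex_convex_hull) auto
    also have "(1 - \<eta>) *\<^sub>R (\<theta>, v) + \<eta> *\<^sub>R (\<rho>, ?C) = (vec \<pi>, (1 - \<eta>) * v + \<eta> * ?C)"
      using \<eta> by (simp add: vec_eq_iff vec_def \<rho>_def)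
    finally have "Gamma_functional \<pi> \<le> ereal ((1 - \<eta>) * v + \<eta> * ?C)" by (rule K_Gamma)
    moreover have "(1 - \<eta>) * v + \<eta> * ?C < g'"
    proof -
      have "\<eta> * m \<le> \<eta>" using mult_left_mono[OF m1, of \<eta>] \<eta>(1) by simp
      then have "v \<le> g + \<eta>" using d2 by linarith
      then have "(1 - \<eta>) * v \<le> (1 - \<eta>) * (g + \<eta>)" using \<eta> by (intro mult_left_mono) auto
      also have "\<dots> = g + \<eta> - \<eta> * g - \<eta> * \<eta>" by (simp add: algebra_simps)
      also have "\<dots> \<le> g + \<eta> + \<eta> * \<bar>g\<bar>"
      proof -
        have "\<eta> * (- g) \<le> \<eta> * \<bar>g\<bar>" "0 \<le> \<eta> * \<eta>"
          using \<eta>(1) by (intro mult_left_mono) auto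
        then show ?thesis by linarith
      qed
      finally show ?thesis using \<eta>3 by (simp add: algebra_simps)
    qed
    ultimately have "Gamma_functional \<pi> < ereal g'" by (meson le_less_trans less_ereal.simps(1))
    then show False using g'(2) by simp
  qed
  moreover have "convex (closure K)" unfolding K_def by (intro convex_closure convex_convex_hull)
  ultimately have "\<exists>a b. inner a (vec \<pi>, g) < b \<and> (\<forall>x\<in>closure K. b < inner a x)"
    by (intro separating_hyperplane_closed_point closed_closure)
  then obtain a b where ab: "inner a (vec \<pi>, g) < b" and "\<forall>x\<in>closure K. b < inner a x"
    by (elim exE conjE)
  then have ab2: "b < inner a x" if "x \<in> K" for x
    using that closure_subset by blast
  obtain a1 l where a: "a = (a1, l)" by fastforce
  have inner_vec: "inner a (vec \<theta>, v) = (\<Sum>z\<in>UNIV. a1 $ z * pmf \<theta> z) + l * v" for \<theta> v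
    by (simp add: a inner_vec_def vec_def)
  \<comment> \<open>\<open>K\<close> contains a point straight above \<open>(vec \<pi>, g)\<close>.
    Separation from it makes the last coefficient positive, so the hyperplane is not
    vertical.\<close>
  have "inner a (vec \<pi>, g) < inner a (vec \<pi>, ?C)"
    using ab ab2[OF vec_\<pi>] by (rule less_trans)
  then have "l * g < l * ?C" by (simp add: inner_vec)
  then have l: "0 < l" using gC by (simp add: mult_less_cancel_left)
  \<comment> \<open>The height of the hyperplane. The constant \<open>b\<close> may be put into
    every value of \<open>\<phi>\<close> since probabilities sum to one.\<close>
  define \<phi> where "\<phi> z = (b - a1 $ z) / l" for z
  have E\<phi>: "expect \<theta> \<phi> = (b - (\<Sum>z\<in>UNIV. a1 $ z * pmf \<theta> z)) / l" for \<theta>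
  proof -
    have "expect \<theta> \<phi> = (\<Sum>z\<in>UNIV. \<phi> z * pmf \<theta> z)"
      by (rule integral_measure_pmf_real) auto
    also have "\<dots> = (b * (\<Sum>z\<in>UNIV. pmf \<theta> z) - (\<Sum>z\<in>UNIV. a1 $ z * pmf \<theta> z)) / l"
      by (simp add: \<phi>_def sum_divide_distrib[symmetric] left_diff_distrib sum_subtractf sum_distrib_left)
    finally show ?thesis by (simp add: sum_pmf_eq_1)
  qed
  show thesis
  proof
    show "g \<le> expect \<pi> \<phi>"
      using ab l by (simp add: E\<phi> inner_vec field_simps)
    show "coupling_bound (\<lambda>x y. (x, y) \<in> set_pmf \<pi>) (\<lambda>z. - ln (pmf \<pi> z)) \<phi>"
      unfolding coupling_bound_def
    proof (intro allI impI)
      fix P :: "'a pmf" and Q :: "'b pmf"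
      assume "\<forall>x\<in>set_pmf P. \<forall>y\<in>set_pmf Q. (x, y) \<in> set_pmf \<pi>"
      then have supp: "set_pmf P \<times> set_pmf Q \<subseteq> set_pmf \<pi>" by blast
      then have "(vec (pair_pmf P Q), transport \<pi> P Q - ent P - ent Q) \<in> S"
        unfolding S_def by blast
      then have "(vec (pair_pmf P Q), transport \<pi> P Q - ent P - ent Q) \<in> K"
        unfolding K_def by (rule hull_inc)
      \<comment> \<open>Separation is strict, so the left-hand side stays below the supremum and
        some coupling costs at least as much.\<close>
      from ab2[OF this] have "ent P + ent Q + expect (pair_pmf P Q) \<phi> < transport \<pi> P Q"
        using l by (simp add: E\<phi> inner_vec field_simps)
      from less_transport[OF supp this]
      show "\<exists>R\<in>couplings P Q. ent P + ent Q + expect (pair_pmf P Q) \<phi> \<le> expect R (\<lambda>z. - ln (pmf \<pi> z))"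
        by blast
    qed
  qed
qed

section \<open>Kantorovich duality up to a small error\<close>

text \<open>The potentials are the coefficients of a hyperplane between two sets: the convex hull of
  single pairs with their costs, and the marginals \<open>P\<close>, \<open>Q\<close> together with
  a cost just above the optimum. The slack \<open>\<delta>\<close> keeps this target outside the
  hull.\<close>

lemma kantorovich_potentials:
  fixes \<pi> :: "('a::finite \<times> 'b::finite) pmf"
  assumes supp: "set_pmf P \<times> set_pmf Q \<subseteq> set_pmf \<pi>" and \<delta>: "0 < \<delta>"
  obtains f g where "\<And>x y. x \<in> set_pmf P \<Longrightarrow> y \<in> set_pmf Q \<Longrightarrow> - ln (pmf \<pi> (x, y)) \<le> f x + g y"
    "expect P f + expect Q g \<le> transport \<pi> P Q + \<delta>"
proof -
  let ?c = "\<lambda>z. - ln (pmf \<pi> z)"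
  let ?I = "set_pmf P \<times> set_pmf Q"
  let ?T = "transport \<pi> P Q"
  define pt :: "'a \<times> 'b \<Rightarrow> (real ^ 'a) \<times> (real ^ 'b) \<times> real" where
    "pt z = (axis (fst z) 1, axis (snd z) 1, ?c z)" for z
  define target :: "(real ^ 'a) \<times> (real ^ 'b) \<times> real" where
    "target = ((\<chi> x. pmf P x), (\<chi> y. pmf Q y), ?T + \<delta>)"
  define H where "H = convex hull (pt ` ?I)"
  define plan where "plan r = ((\<chi> x. \<Sum>y\<in>UNIV. r (x, y)), (\<chi> y. \<Sum>x\<in>UNIV. r (x, y)),
    (\<Sum>z\<in>UNIV. r z * ?c z))" for r :: "'a \<times> 'b \<Rightarrow> real"
  define D where "D = {r :: 'a \<times> 'b \<Rightarrow> real. (\<forall>z. 0 \<le> r z) \<and> (\<Sum>z\<in>UNIV. r z) = 1 \<and> (\<forall>z. z \<notin> ?I \<longrightarrow> r z = 0)}"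
  \<comment> \<open>Each point of the hull consists of the marginals and the cost of a joint law on
    the product of the supports.\<close>
  have H_plan: "H \<subseteq> plan ` D"
    unfolding H_def
  proof (rule hull_minimal)
    show "pt ` ?I \<subseteq> plan ` D"
    proof
      fix p assume "p \<in> pt ` ?I"
      then obtain x y where xy: "x \<in> set_pmf P" "y \<in> set_pmf Q" "p = pt (x, y)" by blast
      define e :: "'a \<times> 'b \<Rightarrow> real" where "e z = (if z = (x, y) then 1 else 0)" for z
      have eD: "e \<in> D" using xy by (auto simp: D_def e_def)
      have marg: "(\<Sum>y'\<in>UNIV. e (x', y')) = (if x' = x then 1 else 0)"
        "(\<Sum>x'\<in>UNIV. e (x', y')) = (if y' = y then 1 else 0)" for x' y'
        by (auto simp: e_def)
      have "(\<Sum>z\<in>UNIV. e z * ?c z) = (\<Sum>z\<in>UNIV. if z = (x, y) then ?c z else 0)"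
        by (intro sum.cong) (auto simp: e_def)
      then have "pt (x, y) = plan e"
        by (auto simp: pt_def plan_def vec_eq_iff axis_def marg)
      then show "p \<in> plan ` D" using xy(3) eD by blast
    qed
    show "convex (plan ` D)"
      unfolding convex_def
    proof (intro ballI allI impI)
      fix p q :: "(real ^ 'a) \<times> (real ^ 'b) \<times> real" and u v :: real
      assume "p \<in> plan ` D" "q \<in> plan ` D" and uv: "0 \<le> u" "0 \<le> v" "u + v = 1"
      then obtain r s where rs: "r \<in> D" "s \<in> D" and pq: "p = plan r" "q = plan s" by blast
      have "(\<lambda>z. u * r z + v * s z) \<in> D"
        using rs uv by (auto simp: D_def sum.distrib sum_distrib_left[symmetric])
      moreover have "u *\<^sub>R plan r + v *\<^sub>R plan s = plan (\<lambda>z. u * r z + v * s z)"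
        by (simp add: plan_def vec_eq_iff sum.distrib sum_distrib_left sum_subtractf sum_negf algebra_simps)
      ultimately show "u *\<^sub>R p + v *\<^sub>R q \<in> plan ` D" unfolding pq by blast
    qed
  qed
  \<comment> \<open>Otherwise some coupling of \<open>P\<close> and \<open>Q\<close> would cost more
    than the optimum.\<close>
  have "target \<notin> H"
  proof
    assume "target \<in> H"
    then obtain r where r: "r \<in> D" "target = plan r" using H_plan by blast
    have r0: "0 \<le> r z" for z using r(1) unfolding D_def mem_Collect_eq by blast
    define R where "R = embed_pmf r"
    have pmfR: "pmf R z = r z" for z
      unfolding R_def
    proof (rule pmf_embed_pmf)
      have "(\<integral>\<^sup>+ z. ennreal (r z) \<partial>count_space UNIV) = ennreal (\<Sum>z\<in>UNIV. r z)"
        unfolding nn_integral_count_space_finite[OF finite] by (intro sum_ennreal r0)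
      then show "(\<integral>\<^sup>+ z. ennreal (r z) \<partial>count_space UNIV) = 1" using r(1) by (simp add: D_def)
    qed (rule r0)
    have "map_pmf fst R = P"
    proof (rule pmf_eqI)
      fix x
      have "pmf (map_pmf fst R) x = (\<Sum>z\<in>fst -` {x}. pmf R z)"
        by (simp add: pmf_map measure_measure_pmf_finite)
      also have "\<dots> = (\<Sum>y\<in>UNIV. r (x, y))"
        by (intro sum.reindex_bij_witness[of _ "\<lambda>y. (x, y)" snd]) (auto simp: pmfR)
      also have "\<dots> = pmf P x" using r(2) by (auto simp: target_def plan_def vec_eq_iff)
      finally show "pmf (map_pmf fst R) x = pmf P x" .
    qed
    moreover have "map_pmf snd R = Q"
    proof (rule pmf_eqI)
      fix y
      have "pmf (map_pmf snd R) y = (\<Sum>z\<in>snd -` {y}. pmf R z)"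
        by (simp add: pmf_map measure_measure_pmf_finite)
      also have "\<dots> = (\<Sum>x\<in>UNIV. r (x, y))"
        by (intro sum.reindex_bij_witness[of _ "\<lambda>x. (x, y)" fst]) (auto simp: pmfR)
      also have "\<dots> = pmf Q y" using r(2) by (auto simp: target_def plan_def vec_eq_iff)
      finally show "pmf (map_pmf snd R) y = pmf Q y" .
    qed
    ultimately have "R \<in> couplings P Q" by (simp add: couplings_def)
    then have "expect R ?c \<le> ?T" by (rule expect_le_transport[OF supp])
    moreover have "expect R ?c = (\<Sum>z\<in>UNIV. r z * ?c z)"
      by (subst integral_measure_pmf_real[of UNIV]) (auto simp: pmfR mult.commute)
    moreover have "\<dots> = ?T + \<delta>" using r(2) by (simp add: target_def plan_def)
    ultimately show False using \<delta> by simp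
  qed
  moreover have "convex H" unfolding H_def by (rule convex_convex_hull)
  moreover have "closed H" unfolding H_def
    by (intro compact_imp_closed finite_imp_compact_convex_hull) auto
  ultimately have "\<exists>a b. inner a target < b \<and> (\<forall>x\<in>H. b < inner a x)"
    by (intro separating_hyperplane_closed_point)
  then obtain a b where ab: "inner a target < b" "\<And>x. x \<in> H \<Longrightarrow> b < inner a x" by blast
  obtain a1 a2 l where a: "a = (a1, a2, l)" using prod_cases3 by blast
  have inner_pt: "inner a (pt (x, y)) = a1 $ x + a2 $ y + l * ?c (x, y)" for x y
    by (simp add: a pt_def inner_axis)
  have inner_target: "inner a target = expect P (\<lambda>x. a1 $ x) + expect Q (\<lambda>y. a2 $ y) + l * (?T + \<delta>)"
    by (simp add: a target_def inner_vec_def integral_measure_pmf_real[of UNIV])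
  have pt_gt: "b < a1 $ x + a2 $ y + l * ?c (x, y)" if "x \<in> set_pmf P" "y \<in> set_pmf Q" for x y
    using ab(2)[of "pt (x, y)"] that unfolding inner_pt[symmetric] H_def by (blast intro: hull_inc)
  \<comment> \<open>Averaging the separation over the product coupling, which has the marginals of
    the target, cancels \<open>a1\<close> and \<open>a2\<close> and reveals the sign of
    \<open>l\<close>.\<close>
  let ?E = "expect (pair_pmf P Q)"
  have fin: "finite (set_pmf (pair_pmf P Q))" by simp
  have "b \<le> ?E (\<lambda>z. a1 $ fst z + (a2 $ snd z + l * ?c z))"
    using expect_mono_finite[OF fin, of "\<lambda>_. b" "\<lambda>z. a1 $ fst z + (a2 $ snd z + l * ?c z)"] pt_gt
    by (force simp: add.assoc intro: less_imp_le)
  also have "\<dots> = ?E (\<lambda>z. a1 $ fst z) + (?E (\<lambda>z. a2 $ snd z) + ?E (\<lambda>z. l * ?c z))"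
    by (simp only: expect_add_finite[OF fin])
  also have "?E (\<lambda>z. a1 $ fst z) = expect P (\<lambda>x. a1 $ x)"
    using integral_map_pmf[of fst "pair_pmf P Q" "\<lambda>x. a1 $ x"] by (simp add: map_fst_pair_pmf)
  also have "?E (\<lambda>z. a2 $ snd z) = expect Q (\<lambda>y. a2 $ y)"
    using integral_map_pmf[of snd "pair_pmf P Q" "\<lambda>y. a2 $ y"] by (simp add: map_snd_pair_pmf)
  also have "?E (\<lambda>z. l * ?c z) = l * ?E ?c" by (rule integral_mult_right_zero)
  finally have "l * (?T + \<delta>) < l * ?E ?c" using ab(1) unfolding inner_target by linarith
  moreover have "?E ?c < ?T + \<delta>"
    using expect_le_transport[OF supp pair_in_couplings] \<delta> by linarith
  ultimately have l: "l < 0" by (smt (verit) mult_left_mono)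
  show thesis
  proof
    \<comment> \<open>Dividing by the negative \<open>l\<close> reverses the separation. The
      constant \<open>b\<close> is assigned to the first potential.\<close>
    show "- ln (pmf \<pi> (x, y)) \<le> (b - a1 $ x) / l + (- a2 $ y) / l"
      if "x \<in> set_pmf P" "y \<in> set_pmf Q" for x y
    proof -
      have "- ln (pmf \<pi> (x, y)) \<le> (b - a1 $ x - a2 $ y) / l"
        using pt_gt[OF that] l by (simp add: neg_le_divide_eq mult.commute)
      then show ?thesis by (simp add: diff_divide_distrib)
    qed
    have "expect P (\<lambda>x. (b - a1 $ x) / l) = expect P (\<lambda>x. b / l + (- 1 / l) * a1 $ x)"
      by (simp add: diff_divide_distrib)
    also have "\<dots> = b / l + (- 1 / l) * expect P (\<lambda>x. a1 $ x)"
      by (subst expect_add_finite) simp_all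
    finally have "expect P (\<lambda>x. (b - a1 $ x) / l) + expect Q (\<lambda>y. (- a2 $ y) / l)
        = (b - expect P (\<lambda>x. a1 $ x) - expect Q (\<lambda>y. a2 $ y)) / l"
      by (simp add: diff_divide_distrib)
    also have "\<dots> \<le> ?T + \<delta>"
      using ab(1) l unfolding inner_target by (simp add: neg_divide_le_eq mult.commute)
    finally show "expect P (\<lambda>x. (b - a1 $ x) / l) + expect Q (\<lambda>y. (- a2 $ y) / l) \<le> ?T + \<delta>" .
  qed
qed

section \<open>Covering by a codebook\<close>

lemma exists_le_expect:
  assumes "finite (set_pmf p)"
  obtains x where "x \<in> set_pmf p" "f x \<le> expect p f"
proof -
  let ?m = "Min (f ` set_pmf p)"
  have "expect p (\<lambda>_. ?m) \<le> expect p f"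
    using assms by (intro expect_mono_finite) auto
  moreover have "?m \<in> f ` set_pmf p" using assms by (intro Min_in) (auto simp: set_pmf_not_empty)
  ultimately show thesis using that by auto
qed

text \<open>Words are picked one after another. Drawing the next word from \<open>U\<close>
  multiplies the mean of the exponential potential by at most \<open>1 + t * m\<close>, and some
  word does no worse than the mean.\<close>

lemma covering_list:
  fixes U :: "'u pmf" and Z :: "'u \<Rightarrow> 's \<Rightarrow> real" and t m :: real
  assumes finS: "finite S" and finU: "finite (set_pmf U)" and t: "0 \<le> t"
    and Z: "\<And>u z. u \<in> set_pmf U \<Longrightarrow> z \<in> S \<Longrightarrow> 0 \<le> Z u z"
    and m: "\<And>z. z \<in> S \<Longrightarrow> expect U (\<lambda>u. Z u z) \<le> m"
  shows "\<exists>us. length us = N \<and> set us \<subseteq> set_pmf U \<and>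
    (\<Sum>z\<in>S. \<Prod>u\<leftarrow>us. 1 + t * Z u z) \<le> card S * (1 + t * m) ^ N"
proof (induction N)
  case 0
  then show ?case by simp
next
  case (Suc N)
  show ?case
  proof (cases "S = {}")
    \<comment> \<open>With \<open>S\<close> empty the hypotheses do not determine the sign of
      \<open>m\<close>, so this case is separate.\<close>
    case True
    obtain u where "u \<in> set_pmf U" using set_pmf_not_empty by fast
    then show ?thesis using True by (intro exI[of _ "replicate (Suc N) u"]) auto
  next
    case False
    have m0: "0 \<le> m"
    proof -
      obtain z where z: "z \<in> S" using False by blast
      have "0 \<le> expect U (\<lambda>u. Z u z)"
        using Z z by (intro integral_nonneg_AE) (auto simp: AE_measure_pmf_iff)
      then show ?thesis using m[OF z] by linarith
    qed
    obtain us where us: "length us = N" "set us \<subseteq> set_pmf U"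
      "(\<Sum>z\<in>S. \<Prod>u\<leftarrow>us. 1 + t * Z u z) \<le> card S * (1 + t * m) ^ N"
      using Suc.IH by blast
    let ?pot = "\<lambda>z. \<Prod>u\<leftarrow>us. 1 + t * Z u z"
    have pot: "0 \<le> ?pot z" if "z \<in> S" for z
      using us(2) Z[OF _ that] t by (intro prod_list_nonneg) (auto simp: subset_iff)
    obtain v where v: "v \<in> set_pmf U"
      "(\<Sum>z\<in>S. (1 + t * Z v z) * ?pot z) \<le> expect U (\<lambda>v. \<Sum>z\<in>S. (1 + t * Z v z) * ?pot z)"
      using exists_le_expect[OF finU, of "\<lambda>v. \<Sum>z\<in>S. (1 + t * Z v z) * ?pot z"] .
    have int: "integrable (measure_pmf U) f" for f :: "'u \<Rightarrow> real"
      by (rule integrable_measure_pmf_finite[OF finU])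
    have "expect U (\<lambda>v. \<Sum>z\<in>S. (1 + t * Z v z) * ?pot z)
        = (\<Sum>z\<in>S. (1 + t * expect U (\<lambda>v. Z v z)) * ?pot z)"
      by (subst Bochner_Integration.integral_sum)
         (simp_all add: int)
    also have "\<dots> \<le> (\<Sum>z\<in>S. (1 + t * m) * ?pot z)"
      using m pot t by (intro sum_mono mult_right_mono add_left_mono mult_left_mono) auto
    also have "\<dots> = (1 + t * m) * (\<Sum>z\<in>S. ?pot z)" by (simp add: sum_distrib_left)
    also have "\<dots> \<le> (1 + t * m) * (card S * (1 + t * m) ^ N)"
      using us(3) m0 t by (intro mult_left_mono) auto
    finally have "(\<Sum>z\<in>S. \<Prod>u\<leftarrow>v # us. 1 + t * Z u z) \<le> card S * (1 + t * m) ^ Suc N"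
      using v(2) by (simp add: algebra_simps)
    then show ?thesis using us v(1) by (intro exI[of _ "v # us"]) simp
  qed
qed

text \<open>The convex function \<open>(1 + t)^x\<close> lies below its chord on the unit
  interval.\<close>

lemma exp_le_affine:
  fixes x t :: real
  assumes "0 \<le> x" "x \<le> 1" "0 \<le> t"
  shows "exp (x * ln (1 + t)) \<le> 1 + t * x"
proof -
  have "exp ((1 - x) *\<^sub>R 0 + x *\<^sub>R ln (1 + t)) \<le> (1 - x) * exp 0 + x * exp (ln (1 + t))"
    using assms by (intro convex_onD[OF exp_convex]) auto
  then show ?thesis using assms by (simp add: algebra_simps)
qed

text \<open>Divided by \<open>K * pmf p z\<close>, the densities lie in the unit interval and have
  mean at most \<open>(1 + \<eta>) / K\<close>. One summand of the potential is at most the total,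
  so a single codebook works for all \<open>z\<close>. The price is
  \<open>ln (card (set_pmf p))\<close>, which the hypothesis \<open>N\<close> absorbs; hence
  \<open>N\<close> need exceed \<open>K\<close> only by a factor of the order of this
  logarithm.\<close>

lemma covering_codebook:
  fixes U :: "'u pmf" and F :: "'u \<Rightarrow> 's pmf"
  assumes finp: "finite (set_pmf p)" and finU: "finite (set_pmf U)"
    and K: "0 < K" and \<eta>: "0 < \<eta>" "\<eta> \<le> 1"
    and bounded: "\<And>u z. u \<in> set_pmf U \<Longrightarrow> pmf (F u) z \<le> K * pmf p z"
    and mean: "\<And>z. pmf (bind_pmf U F) z \<le> (1 + \<eta>) * pmf p z"
    and N: "K * ln (card (set_pmf p)) \<le> real N * (\<eta> * ln (1 + \<eta>))"
  shows "\<exists>us. length us = N \<and> set us \<subseteq> set_pmf U \<and>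
    (\<forall>z. (\<Sum>u\<leftarrow>us. pmf (F u) z) \<le> real N * (1 + 4 * \<eta>) * pmf p z)"
proof -
  let ?S = "set_pmf p"
  define Z where "Z u z = pmf (F u) z / (K * pmf p z)" for u z
  have Z: "0 \<le> Z u z" "Z u z \<le> 1" if "u \<in> set_pmf U" "z \<in> ?S" for u z
    using bounded[OF that(1), of z] K that(2) by (auto simp: Z_def pmf_positive divide_le_eq)
  have "expect U (\<lambda>u. Z u z) \<le> (1 + \<eta>) / K" if z: "z \<in> ?S" for z
  proof -
    have "expect U (\<lambda>u. Z u z) = pmf (bind_pmf U F) z / (K * pmf p z)"
      unfolding Z_def pmf_bind by simp
    also have "\<dots> \<le> (1 + \<eta>) * pmf p z / (K * pmf p z)"
      using mean[of z] K by (intro divide_right_mono) auto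
    also have "\<dots> = (1 + \<eta>) / K" using pmf_positive[OF z] by simp
    finally show ?thesis .
  qed
  then obtain us where us: "length us = N" "set us \<subseteq> set_pmf U"
    "(\<Sum>z\<in>?S. \<Prod>u\<leftarrow>us. 1 + \<eta> * Z u z) \<le> card ?S * (1 + \<eta> * ((1 + \<eta>) / K)) ^ N"
    using covering_list[OF finp finU, of \<eta> Z "(1 + \<eta>) / K" N] \<eta> Z(1) by auto
  have L: "0 < ln (1 + \<eta>)" using \<eta> by simp
  \<comment> \<open>Turns the \<open>\<eta>\<close> coming from the mean into a multiple of
    \<open>ln (1 + \<eta>)\<close>, which then cancels on both sides.\<close>
  have L': "\<eta> \<le> (1 + \<eta>) * ln (1 + \<eta>)"
  proof -
    have "ln (1 / (1 + \<eta>)) \<le> 1 / (1 + \<eta>) - 1" using \<eta> by (intro ln_le_minus_one) auto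
    then have "\<eta> / (1 + \<eta>) \<le> ln (1 + \<eta>)" using \<eta> by (simp add: ln_div field_simps)
    then show ?thesis using \<eta> by (simp add: field_simps)
  qed
  have card: "0 < card ?S" using finp by (simp add: card_gt_0_iff set_pmf_not_empty)
  have "(\<Sum>u\<leftarrow>us. pmf (F u) z) \<le> real N * (1 + 4 * \<eta>) * pmf p z" for z
  proof (cases "z \<in> ?S")
    case True
    have pos: "0 < pmf p z" using True by (rule pmf_positive)
    have Zus: "0 \<le> Z u z \<and> Z u z \<le> 1" if "u \<in> set us" for u
      using that us(2) True Z by blast
    have "exp ((\<Sum>u\<leftarrow>us. Z u z) * ln (1 + \<eta>)) \<le> (\<Prod>u\<leftarrow>us. 1 + \<eta> * Z u z)"
      using Zus
    proof (induction us)
      case (Cons u us)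
      have "exp ((\<Sum>u\<leftarrow>u # us. Z u z) * ln (1 + \<eta>))
          = exp (Z u z * ln (1 + \<eta>)) * exp ((\<Sum>u\<leftarrow>us. Z u z) * ln (1 + \<eta>))"
        by (simp add: distrib_right exp_add)
      also have "\<dots> \<le> (1 + \<eta> * Z u z) * (\<Prod>u\<leftarrow>us. 1 + \<eta> * Z u z)"
        using Cons \<eta> by (intro mult_mono exp_le_affine) auto
      finally show ?case by simp
    qed simp
    also have "\<dots> \<le> (\<Sum>z\<in>?S. \<Prod>u\<leftarrow>us. 1 + \<eta> * Z u z)"
      using True finp us(2) Z \<eta> by (intro member_le_sum prod_list_nonneg) (auto simp: subset_iff)
    also have "\<dots> \<le> card ?S * exp (\<eta> * ((1 + \<eta>) / K)) ^ N"
      using us(3) \<eta> K exp_ge_add_one_self[of "\<eta> * ((1 + \<eta>) / K)"]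
      by (elim order_trans) (intro mult_left_mono power_mono, auto)
    also have "\<dots> = exp (ln (card ?S) + real N * (\<eta> * ((1 + \<eta>) / K)))"
      using card by (simp add: exp_add exp_of_nat_mult[symmetric] mult_ac)
    finally have "(\<Sum>u\<leftarrow>us. Z u z) * ln (1 + \<eta>) \<le> ln (card ?S) + real N * (\<eta> * ((1 + \<eta>) / K))"
      by simp
    then have "K * ((\<Sum>u\<leftarrow>us. Z u z) * ln (1 + \<eta>)) \<le> K * (ln (card ?S) + real N * (\<eta> * ((1 + \<eta>) / K)))"
      using K by (intro mult_left_mono) auto
    also have "\<dots> = K * ln (card ?S) + real N * (\<eta> * (1 + \<eta>))" using K by (simp add: field_simps)
    also have "\<dots> \<le> real N * (\<eta> * ln (1 + \<eta>)) + real N * ((1 + \<eta>) * ln (1 + \<eta>) * (1 + \<eta>))"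
      using N L' \<eta> by (intro add_mono mult_left_mono mult_right_mono) auto
    also have "\<dots> = real N * (\<eta> + (1 + \<eta>)\<^sup>2) * ln (1 + \<eta>)"
      by (simp add: algebra_simps power2_eq_square)
    finally have "K * (\<Sum>u\<leftarrow>us. Z u z) \<le> real N * (\<eta> + (1 + \<eta>)\<^sup>2)"
      using L by (simp add: mult.assoc[symmetric])
    \<comment> \<open>The factor is \<open>1 + 3 * \<eta> + \<eta>^2\<close>, and
      \<open>\<eta> \<le> 1\<close>.\<close>
    also have "\<dots> \<le> real N * (1 + 4 * \<eta>)"
    proof -
      have "\<eta> * \<eta> \<le> \<eta> * 1" using \<eta> by (intro mult_left_mono) auto
      then show ?thesis by (intro mult_left_mono) (auto simp: power2_eq_square algebra_simps)
    qed
    finally have *: "K * (\<Sum>u\<leftarrow>us. Z u z) \<le> real N * (1 + 4 * \<eta>)" .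
    have "(\<Sum>u\<leftarrow>us. pmf (F u) z) = (\<Sum>u\<leftarrow>us. K * pmf p z * Z u z)"
      using pos K by (simp add: Z_def)
    also have "\<dots> = pmf p z * (K * (\<Sum>u\<leftarrow>us. Z u z))"
      by (simp add: sum_list_const_mult mult_ac)
    also have "\<dots> \<le> pmf p z * (real N * (1 + 4 * \<eta>))"
      using * pos by (intro mult_left_mono) auto
    finally show ?thesis by (simp add: mult_ac)
  next
    case False
    have "(\<Sum>u\<leftarrow>us. pmf (F u) z) = (\<Sum>u\<leftarrow>us. 0)"
    proof (intro arg_cong[where f = sum_list] map_cong refl)
      fix u assume "u \<in> set us"
      then have "pmf (F u) z \<le> 0" using bounded[of u z] us(2) False by (auto simp: set_pmf_iff)
      then show "pmf (F u) z = 0" by (simp add: order_antisym)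
    qed
    then show ?thesis using False by (simp add: set_pmf_iff)
  qed
  then show ?thesis using us by blast
qed

section \<open>From a codebook to an exact decomposition\<close>

text \<open>Gibbs' inequality, from \<open>ln t \<le> t - 1\<close>. Total weight below one is
  allowed, so a reference weight on a larger set need not be renormalised.\<close>

lemma ent_le_cross_entropy:
  assumes fin: "finite (set_pmf p)" and q: "\<And>x. x \<in> set_pmf p \<Longrightarrow> 0 < q x"
    and q1: "(\<Sum>x\<in>set_pmf p. q x) \<le> 1"
  shows "ent p \<le> expect p (\<lambda>x. - ln (q x))"
proof -
  have "ent p \<le> expect p (\<lambda>x. - ln (q x) + (q x / pmf p x + - 1))"
    unfolding ent_def
  proof (rule expect_mono_finite[OF fin])
    fix x assume x: "x \<in> set_pmf p"
    have "ln (q x / pmf p x) \<le> q x / pmf p x - 1"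
      using q[OF x] pmf_positive[OF x] by (intro ln_le_minus_one) auto
    then show "- ln (pmf p x) \<le> - ln (q x) + (q x / pmf p x + - 1)"
      using q[OF x] pmf_positive[OF x] by (simp add: ln_div)
  qed
  also have "\<dots> = expect p (\<lambda>x. - ln (q x)) + (expect p (\<lambda>x. q x / pmf p x) + - 1)"
    unfolding expect_add_finite[OF fin] by simp
  also have "expect p (\<lambda>x. q x / pmf p x) = (\<Sum>x\<in>set_pmf p. q x / pmf p x * pmf p x)"
    using fin by (intro integral_measure_pmf_real) auto
  also have "\<dots> = (\<Sum>x\<in>set_pmf p. q x)"
    by (intro sum.cong) (auto simp: set_pmf_iff)
  finally show ?thesis using q1 by simp
qed

text \<open>Codebook decompositions live on a sum type, whereas \<open>exact_rate\<close> ranges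
  over laws on \<open>nat\<close>. An injective relabelling keeps the entropy.\<close>

lemma markov_decomposition_nat:
  fixes W :: "'w pmf"
  assumes md: "markov_decomposition p W P Q" and fin: "finite (set_pmf W)"
  obtains W' :: "nat pmf" and P' Q' where "markov_decomposition p W' P' Q'"
    "shannon_entropy W' = ennreal (ent W)"
proof -
  obtain f :: "'w \<Rightarrow> nat" where f: "inj_on f (set_pmf W)"
    using finite_imp_inj_to_nat_seg[OF fin] by blast
  let ?g = "inv_into (set_pmf W) f"
  have "bind_pmf (map_pmf f W) (\<lambda>w. pair_pmf (P (?g w)) (Q (?g w))) = bind_pmf W (\<lambda>w. pair_pmf (P w) (Q w))"
    unfolding bind_map_pmf using f by (intro bind_pmf_cong) auto
  then have "markov_decomposition p (map_pmf f W) (\<lambda>w. P (?g w)) (\<lambda>w. Q (?g w))"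
    using md by (simp add: markov_decomposition_def)
  moreover have "shannon_entropy (map_pmf f W) = ennreal (ent W)"
    using fin by (simp add: shannon_entropy_eq_ent ent_map_inj[OF f])
  ultimately show thesis by (rule that)
qed

text \<open>The uniform mixture over the codebook is dominated by \<open>(1 + \<kappa>) p\<close>,
  so it enters \<open>p\<close> with weight \<open>1 / (1 + \<kappa>)\<close> and the rest is a
  multiple of a law. Sending a pair of the rest itself makes both kernels point masses, so the
  decomposition is exact; the weight of the rest is at most \<open>\<kappa>\<close>, which keeps its
  contribution to the entropy small.\<close>

lemma codebook_decomposition:
  fixes p :: "('x \<times> 'y) pmf"
  assumes finp: "finite (set_pmf p)" and \<kappa>: "0 < \<kappa>" and N: "0 < N"
    and le: "\<And>z. (\<Sum>i<N. pmf (pair_pmf (A i) (B i)) z) \<le> real N * (1 + \<kappa>) * pmf p z"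
  obtains W :: "nat pmf" and P Q where "markov_decomposition p W P Q"
    "shannon_entropy W \<le> ennreal (ln 2 + ln N + \<kappa> * ln (card (set_pmf p)))"
proof -
  define avg where "avg z = (\<Sum>i<N. pmf (pair_pmf (A i) (B i)) z) / N" for z
  have avg_eq: "avg z = pmf (bind_pmf (pmf_of_set {..<N}) (\<lambda>i. pair_pmf (A i) (B i))) z" for z
    using N by (subst pmf_bind_pmf_of_set) (auto simp: avg_def)
  have avg_le: "avg z \<le> (1 + \<kappa>) * pmf p z" for z
    using le[of z] N by (simp add: avg_def divide_le_eq mult_ac)
  \<comment> \<open>The normalised rest; its mass is one because \<open>p\<close> and
    \<open>avg\<close> both have mass one.\<close>
  define \<rho> where "\<rho> = embed_pmf (\<lambda>z. ((1 + \<kappa>) * pmf p z - avg z) / \<kappa>)"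
  have avg_supp: "set_pmf (bind_pmf (pmf_of_set {..<N}) (\<lambda>i. pair_pmf (A i) (B i))) \<subseteq> set_pmf p"
  proof
    fix z assume z: "z \<in> set_pmf (bind_pmf (pmf_of_set {..<N}) (\<lambda>i. pair_pmf (A i) (B i)))"
    have "0 < (1 + \<kappa>) * pmf p z"
      using pmf_positive[OF z] avg_le[of z] by (simp only: avg_eq)
    then show "z \<in> set_pmf p" by (auto simp: set_pmf_iff)
  qed
  have avg0: "avg z = 0" if "pmf p z = 0" for z
    using that avg_supp unfolding avg_eq by (metis pmf_eq_0_set_pmf subsetD)
  have pmf\<rho>: "pmf \<rho> z = ((1 + \<kappa>) * pmf p z - avg z) / \<kappa>" for z
    unfolding \<rho>_def
  proof (rule pmf_embed_pmf)
    show "0 \<le> ((1 + \<kappa>) * pmf p z - avg z) / \<kappa>" for z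
      using avg_le[of z] \<kappa> by simp
    then have "(\<integral>\<^sup>+ z. ennreal (((1 + \<kappa>) * pmf p z - avg z) / \<kappa>) \<partial>count_space UNIV)
        = ennreal (\<Sum>z\<in>set_pmf p. ((1 + \<kappa>) * pmf p z - avg z) / \<kappa>)"
      using finp by (subst nn_integral_count_space'[of "set_pmf p"])
        (auto simp: avg0 set_pmf_iff sum_ennreal)
    also have "(\<Sum>z\<in>set_pmf p. ((1 + \<kappa>) * pmf p z - avg z) / \<kappa>)
        = ((1 + \<kappa>) * (\<Sum>z\<in>set_pmf p. pmf p z) - (\<Sum>z\<in>set_pmf p. avg z)) / \<kappa>"
      by (simp add: sum_divide_distrib[symmetric] sum_subtractf sum_distrib_left)
    also have "\<dots> = 1"
      using finp avg_supp \<kappa> by (simp add: sum_pmf_eq_1 avg_eq)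
    finally show "(\<integral>\<^sup>+ z. ennreal (((1 + \<kappa>) * pmf p z - avg z) / \<kappa>) \<partial>count_space UNIV) = 1"
      by simp
  qed
  have set\<rho>: "set_pmf \<rho> \<subseteq> set_pmf p"
  proof
    fix z assume "z \<in> set_pmf \<rho>"
    then have "0 < ((1 + \<kappa>) * pmf p z - avg z) / \<kappa>" unfolding pmf\<rho>[symmetric] by (rule pmf_positive)
    moreover have "0 \<le> avg z" unfolding avg_eq by simp
    ultimately have "0 < (1 + \<kappa>) * pmf p z" using \<kappa> by (simp add: zero_less_divide_iff)
    then show "z \<in> set_pmf p" by (auto simp: set_pmf_iff)
  qed
  have fin\<rho>: "finite (set_pmf \<rho>)" using set\<rho> finp finite_subset by blast
  define a where "a = 1 / (1 + \<kappa>)"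
  have a: "0 \<le> a" "a \<le> 1" "1 - a \<le> \<kappa>" using \<kappa> by (auto simp: a_def field_simps)
  define W where "W = bind_pmf (bernoulli_pmf a)
    (\<lambda>b. if b then map_pmf Inl (pmf_of_set {..<N}) else map_pmf Inr \<rho>)"
  define P where "P = case_sum A (\<lambda>z :: 'x \<times> 'y. return_pmf (fst z))"
  define Q where "Q = case_sum B (\<lambda>z :: 'x \<times> 'y. return_pmf (snd z))"
  have ne: "{..<N} \<noteq> {}" using N by auto
  have setW: "set_pmf W \<subseteq> Inl ` {..<N} \<union> Inr ` set_pmf \<rho>"
    by (auto simp: W_def set_pmf_of_set[OF ne finite_lessThan] split: if_splits)
  have finW: "finite (set_pmf W)" by (rule finite_subset[OF setW]) (simp add: fin\<rho>)
  have "bind_pmf W (\<lambda>w. pair_pmf (P w) (Q w)) = p"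
  proof (rule pmf_eqI)
    fix z
    have "bind_pmf W (\<lambda>w. pair_pmf (P w) (Q w)) = bind_pmf (bernoulli_pmf a)
        (\<lambda>b. if b then bind_pmf (pmf_of_set {..<N}) (\<lambda>i. pair_pmf (A i) (B i)) else \<rho>)"
      unfolding W_def bind_assoc_pmf
      by (intro bind_pmf_cong refl)
         (auto simp: bind_map_pmf P_def Q_def pair_pmf_def bind_return_pmf bind_return_pmf')
    then have "pmf (bind_pmf W (\<lambda>w. pair_pmf (P w) (Q w))) z = avg z * a + pmf \<rho> z * (1 - a)"
      using a by (simp add: pmf_bind integral_bernoulli_pmf avg_eq)
    also have "1 - a = \<kappa> * a" using \<kappa> by (simp add: a_def field_simps)
    also have "avg z * a + pmf \<rho> z * (\<kappa> * a) = avg z * a + ((1 + \<kappa>) * pmf p z - avg z) * a"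
      using \<kappa> by (simp add: pmf\<rho>)
    also have "\<dots> = pmf p z * (a * (1 + \<kappa>))" by (simp add: algebra_simps)
    also have "a * (1 + \<kappa>) = 1" using \<kappa> by (simp add: a_def)
    also have "pmf p z * 1 = pmf p z" by simp
    finally show "pmf (bind_pmf W (\<lambda>w. pair_pmf (P w) (Q w))) z = pmf p z" .
  qed
  then have md: "markov_decomposition p W P Q" by (simp add: markov_decomposition_def)
  have card: "0 < card (set_pmf p)" using finp by (simp add: card_gt_0_iff set_pmf_not_empty)
  \<comment> \<open>Half of the reference weight is uniform over the indices, half uniform over the
    support of \<open>p\<close>. An index then costs \<open>ln (2 * N)\<close>, and a pair costs
    \<open>ln 2\<close> plus the logarithm of the size of that support.\<close>
  define q where "q = case_sum (\<lambda>_::nat. 1 / (2 * real N)) (\<lambda>_::'x \<times> 'y. 1 / (2 * real (card (set_pmf p))))"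
  have "ent W \<le> expect W (\<lambda>w. - ln (q w))"
  proof (rule ent_le_cross_entropy[OF finW])
    show "0 < q w" for w using N card by (auto simp: q_def split: sum.split)
    have "(\<Sum>w\<in>set_pmf W. q w) \<le> (\<Sum>w\<in>Inl ` {..<N} \<union> Inr ` set_pmf p. q w)"
    proof (intro sum_mono2)
      show "set_pmf W \<subseteq> Inl ` {..<N} \<union> Inr ` set_pmf p" using setW set\<rho> by blast
    qed (use finp in \<open>auto simp: q_def\<close>)
    also have "\<dots> = (\<Sum>w\<in>Inl ` {..<N}. q w) + (\<Sum>w\<in>Inr ` set_pmf p. q w)"
      using finp by (intro sum.union_disjoint) auto
    also have "\<dots> = 1" using N card by (simp add: sum.reindex q_def)
    finally show "(\<Sum>w\<in>set_pmf W. q w) \<le> 1" .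
  qed
  also have "expect W (\<lambda>w. - ln (q w))
      = a * ln (2 * N) + (1 - a) * ln (2 * card (set_pmf p))"
    unfolding W_def using ne fin\<rho> a N card
    by (subst expect_bind_finite) (auto simp: q_def ln_div set_pmf_of_set[OF ne finite_lessThan])
  also have "\<dots> = ln 2 + a * ln N + (1 - a) * ln (card (set_pmf p))"
    using N card by (simp add: ln_mult algebra_simps)
  also have "\<dots> \<le> ln 2 + 1 * ln N + \<kappa> * ln (card (set_pmf p))"
    using a N card by (intro add_mono mult_right_mono) auto
  finally have ent: "ent W \<le> ln 2 + ln N + \<kappa> * ln (card (set_pmf p))" by simp
  obtain W' :: "nat pmf" and P' Q' where W': "markov_decomposition p W' P' Q'"
    "shannon_entropy W' = ennreal (ent W)"
    using markov_decomposition_nat[OF md finW] .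
  show thesis using W' ent by (intro that[OF W'(1)]) (simp add: ennreal_leI)
qed

text \<open>\<open>U\<close> is conditioned on words with small bad masses, and the two kernels are
  conditioned separately, which preserves conditional independence. Probabilities grow at most by
  the factor \<open>1 / ((1 - 2 * s) * (1 - s)^2)\<close>, so the mixture is dominated by
  \<open>(1 + \<eta>) p\<close>, while the bound \<open>good\<close> now holds at every point up to
  the same factor.\<close>

lemma condition_kernels:
  fixes U :: "'u pmf" and p :: "('x \<times> 'y) pmf"
  assumes finU: "finite (set_pmf U)"
    and md: "markov_decomposition p U A B"
    and badX: "expect U (\<lambda>u. measure (A u) (- GX u)) \<le> s\<^sup>2"
    and badY: "expect U (\<lambda>u. measure (B u) (- GY u)) \<le> s\<^sup>2"
    and good: "\<And>u x y. u \<in> set_pmf U \<Longrightarrow> x \<in> set_pmf (A u) \<Longrightarrow> y \<in> set_pmf (B u) \<Longrightarrow>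
      x \<in> GX u \<Longrightarrow> y \<in> GY u \<Longrightarrow> pmf (A u) x * pmf (B u) y \<le> K * pmf p (x, y)"
    and K: "0 < K" and s: "0 < s" "s < 1/2" and \<eta>: "1 \<le> (1 + \<eta>) * ((1 - 2 * s) * (1 - s)\<^sup>2)"
  obtains U' A' B' where "set_pmf U' \<subseteq> set_pmf U"
    "\<And>u z. u \<in> set_pmf U' \<Longrightarrow> pmf (pair_pmf (A' u) (B' u)) z \<le> (1 + \<eta>) * K * pmf p z"
    "\<And>z. pmf (bind_pmf U' (\<lambda>u. pair_pmf (A' u) (B' u))) z \<le> (1 + \<eta>) * pmf p z"
proof -
  \<comment> \<open>Outside \<open>G\<close> the bad masses sum to more than \<open>s\<close>, and
    their means sum to at most \<open>2 * s^2\<close>. By Markov's inequality, \<open>G\<close>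
    misses mass at most \<open>2 * s\<close>.\<close>
  define G where "G = {u. measure (A u) (- GX u) \<le> s \<and> measure (B u) (- GY u) \<le> s}"
  define A' where "A' u = cond_pmf (A u) (GX u)" for u
  define B' where "B' u = cond_pmf (B u) (GY u)" for u
  define U' where "U' = cond_pmf U G"
  let ?F = "\<lambda>u. pair_pmf (A u) (B u)"
  let ?F' = "\<lambda>u. pair_pmf (A' u) (B' u)"
  have badG: "measure U (- G) \<le> 2 * s"
  proof -
    have "measure U (- G) = expect U (indicator (- G))" by simp
    also have "\<dots> \<le> expect U (\<lambda>u. (measure (A u) (- GX u) + measure (B u) (- GY u)) / s)"
    proof (rule expect_mono_finite[OF finU])
      fix u
      show "indicator (- G) u \<le> (measure (A u) (- GX u) + measure (B u) (- GY u)) / s"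
      proof (cases "u \<in> G")
        case False
        then have "s \<le> measure (A u) (- GX u) + measure (B u) (- GY u)"
          using measure_nonneg[of "A u" "- GX u"] measure_nonneg[of "B u" "- GY u"]
          unfolding G_def mem_Collect_eq by linarith
        then show ?thesis using False s(1) by (simp add: le_divide_eq)
      qed (use s(1) in simp)
    qed
    also have "\<dots> = (expect U (\<lambda>u. measure (A u) (- GX u)) + expect U (\<lambda>u. measure (B u) (- GY u))) / s"
      by (simp add: expect_add_finite[OF finU])
    also have "\<dots> \<le> (s\<^sup>2 + s\<^sup>2) / s"
      using badX badY s(1) by (intro divide_right_mono) auto
    also have "\<dots> = 2 * s" using s(1) by (simp add: power2_eq_square)
    finally show ?thesis .
  qed
  have G: "1 - 2 * s \<le> measure U G"
    using badG measure_pmf.prob_compl[of G U] by (simp add: Compl_eq_Diff_UNIV)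
  have Gpos: "0 < measure U G" using G s by linarith
  have neG: "set_pmf U \<inter> G \<noteq> {}"
    using Gpos by (metis measure_pmf_zero_iff less_irrefl)
  have good_mass: "1 - s \<le> measure (A u) (GX u)" "1 - s \<le> measure (B u) (GY u)" if "u \<in> G" for u
    using that measure_pmf.prob_compl[of "GX u" "A u"] measure_pmf.prob_compl[of "GY u" "B u"]
    by (auto simp: G_def Compl_eq_Diff_UNIV)
  have neA: "set_pmf (A u) \<inter> GX u \<noteq> {}" and neB: "set_pmf (B u) \<inter> GY u \<noteq> {}" if "u \<in> G" for u
    using good_mass[OF that] s by (metis measure_pmf_zero_iff diff_gt_0_iff_gt field_sum_of_halves
      less_add_same_cancel1 not_le order_less_trans zero_less_one half_gt_zero_iff)+
  have pos: "0 < (1 - 2 * s) * (1 - s)\<^sup>2" using s by simp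
  have F'_le: "pmf (?F' u) (x, y) \<le> (if x \<in> GX u \<and> y \<in> GY u then pmf (?F u) (x, y) / (1 - s)\<^sup>2 else 0)"
    if u: "u \<in> G" for u x y
  proof -
    have "pmf (A u) x * pmf (B u) y / (measure (A u) (GX u) * measure (B u) (GY u))
      \<le> pmf (A u) x * pmf (B u) y / ((1 - s) * (1 - s))"
      using good_mass[OF u] s by (intro divide_left_mono mult_mono mult_pos_pos) auto
    then show ?thesis
      by (simp add: pmf_pair A'_def B'_def pmf_cond[OF neA[OF u]] pmf_cond[OF neB[OF u]] power2_eq_square)
  qed
  have F'_le_F: "pmf (?F' u) z \<le> pmf (?F u) z / (1 - s)\<^sup>2" if "u \<in> G" for u z
    using F'_le[OF that, of "fst z" "snd z"] by (auto split: if_splits intro: order_trans)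
  have setU': "set_pmf U' = set_pmf U \<inter> G" unfolding U'_def by (rule set_cond_pmf[OF neG])
  have \<eta>': "1 \<le> (1 + \<eta>) * (1 - s)\<^sup>2"
  proof -
    have "0 < 1 + \<eta>" using \<eta> pos by (metis less_le_trans zero_less_mult_iff zero_less_one not_less_iff_gr_or_eq)
    then have "(1 + \<eta>) * ((1 - 2 * s) * (1 - s)\<^sup>2) \<le> (1 + \<eta>) * (1 * (1 - s)\<^sup>2)"
      using s by (intro mult_left_mono mult_right_mono) auto
    then show ?thesis using \<eta> by simp
  qed
  show thesis
  proof
    show "set_pmf U' \<subseteq> set_pmf U" by (simp add: setU')
    show "pmf (?F' u) z \<le> (1 + \<eta>) * K * pmf p z" if "u \<in> set_pmf U'" for u z
    proof -
      obtain x y where z: "z = (x, y)" by fastforce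
      have u: "u \<in> set_pmf U" "u \<in> G" using that by (auto simp: setU')
      show ?thesis
      proof (cases "x \<in> GX u \<and> y \<in> GY u \<and> x \<in> set_pmf (A u) \<and> y \<in> set_pmf (B u)")
        case True
        then have "pmf (?F u) z \<le> K * pmf p z"
          using good[OF u(1)] by (auto simp: z pmf_pair)
        then have "pmf (?F u) z / (1 - s)\<^sup>2 \<le> K * pmf p z / (1 - s)\<^sup>2"
          by (intro divide_right_mono) auto
        also have "\<dots> = K * pmf p z * (1 / (1 - s)\<^sup>2)" by simp
        also have "\<dots> \<le> K * pmf p z * (1 + \<eta>)"
          using \<eta>' K s by (intro mult_left_mono) (auto simp: divide_le_eq)
        finally show ?thesis using F'_le_F[OF u(2), of z] by (simp add: mult_ac)
      next
        case False
        then have "pmf (?F' u) z \<le> 0"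
          using F'_le[OF u(2), of x y] by (auto simp: z pmf_pair set_pmf_iff split: if_splits)
        also have "0 \<le> (1 + \<eta>) * K * pmf p z"
        proof -
          have "0 \<le> 1 + \<eta>" using \<eta>' s by (smt (verit) mult_nonpos_nonneg zero_le_power2)
          then show ?thesis using K by simp
        qed
        finally show ?thesis .
      qed
    qed
    show "pmf (bind_pmf U' ?F') z \<le> (1 + \<eta>) * pmf p z" for z
    proof -
      have "pmf (bind_pmf U' ?F') z = (\<Sum>u\<in>set_pmf U \<inter> G. pmf (?F' u) z * pmf U' u)"
        unfolding pmf_bind using finU by (intro integral_measure_pmf_real) (auto simp: setU')
      also have "\<dots> \<le> (\<Sum>u\<in>set_pmf U \<inter> G. pmf (?F u) z / (1 - s)\<^sup>2 * (pmf U u / (1 - 2 * s)))"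
      proof (intro sum_mono mult_mono)
        fix u assume u: "u \<in> set_pmf U \<inter> G"
        show "pmf (?F' u) z \<le> pmf (?F u) z / (1 - s)\<^sup>2" using u by (intro F'_le_F) auto
        have "pmf U u / measure U G \<le> pmf U u / (1 - 2 * s)"
          using G s Gpos by (intro divide_left_mono) auto
        then show "pmf U' u \<le> pmf U u / (1 - 2 * s)"
          using u by (simp add: U'_def pmf_cond[OF neG])
      qed auto
      also have "\<dots> \<le> (\<Sum>u\<in>set_pmf U. pmf (?F u) z / (1 - s)\<^sup>2 * (pmf U u / (1 - 2 * s)))"
        using finU s by (intro sum_mono2) auto
      also have "\<dots> = (\<Sum>u\<in>set_pmf U. pmf (?F u) z * pmf U u) * (1 / ((1 - 2 * s) * (1 - s)\<^sup>2))"
        by (simp add: sum_divide_distrib mult_ac)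
      also have "(\<Sum>u\<in>set_pmf U. pmf (?F u) z * pmf U u) = pmf (bind_pmf U ?F) z"
        unfolding pmf_bind using finU by (intro integral_measure_pmf_real[symmetric]) auto
      also have "bind_pmf U ?F = p" using md by (simp add: markov_decomposition_def)
      also have "pmf p z * (1 / ((1 - 2 * s) * (1 - s)\<^sup>2)) \<le> pmf p z * (1 + \<eta>)"
        using \<eta> pos by (intro mult_left_mono) (auto simp: divide_le_eq)
      finally show ?thesis by (simp add: mult_ac)
    qed
  qed
qed

section \<open>Memoryless sequences\<close>

primrec sequence_pmf :: "'a pmf list \<Rightarrow> 'a list pmf" where
  "sequence_pmf [] = return_pmf []"
| "sequence_pmf (p # ps) = bind_pmf p (\<lambda>x. map_pmf (Cons x) (sequence_pmf ps))"

lemma pmf_sequence_Cons: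
  "pmf (sequence_pmf (p # ps)) (x # xs) = pmf p x * pmf (sequence_pmf ps) xs"
proof -
  have eq: "sequence_pmf (p # ps) = map_pmf (\<lambda>(x, xs). x # xs) (pair_pmf p (sequence_pmf ps))"
    by (simp add: pair_pmf_def map_bind_pmf map_pmf_def bind_assoc_pmf bind_return_pmf)
  have "inj (\<lambda>(x, xs). x # xs)" by (auto simp: inj_on_def)
  from pmf_map_inj'[OF this, of "pair_pmf p (sequence_pmf ps)" "(x, xs)"] show ?thesis
    unfolding eq by (simp add: pmf_pair)
qed

lemma finite_sequence_pmf:
  "(\<And>p. p \<in> set ps \<Longrightarrow> finite (set_pmf p)) \<Longrightarrow> finite (set_pmf (sequence_pmf ps))"
  by (induction ps) auto

lemma iid_pair_Suc:
  "iid_pair (Suc n) p = bind_pmf p (\<lambda>(x, y). map_pmf (\<lambda>(xs, ys). (x # xs, y # ys)) (iid_pair n p))"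
  unfolding iid_pair_def
  by (simp add: map_bind_pmf pmf.map_comp o_def case_prod_unfold map_pmf_def[symmetric])

lemma pair_sequence_Cons:
  "pair_pmf (sequence_pmf (p # ps)) (sequence_pmf (q # qs))
   = bind_pmf (pair_pmf p q) (\<lambda>(x, y). map_pmf (\<lambda>(xs, ys). (x # xs, y # ys))
       (pair_pmf (sequence_pmf ps) (sequence_pmf qs)))"
  by (simp add: pair_pmf_def map_pmf_def bind_assoc_pmf bind_return_pmf bind_commute_pmf[of q])

text \<open>Given the word, the first pair of letters is independent of the others, so drawing it
  commutes with drawing the tail of the word.\<close>

lemma markov_decomposition_iid:
  assumes "markov_decomposition p W P Q"
  shows "markov_decomposition (iid_pair n p) (replicate_pmf n W)
    (\<lambda>ws. sequence_pmf (map P ws)) (\<lambda>ws. sequence_pmf (map Q ws))"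
proof (induction n)
  case 0
  show ?case
    by (simp add: markov_decomposition_def iid_pair_def pair_pmf_def bind_return_pmf)
next
  case (Suc n)
  let ?R = "\<lambda>ws. pair_pmf (sequence_pmf (map P ws)) (sequence_pmf (map Q ws))"
  let ?c = "\<lambda>(x, y). map_pmf (\<lambda>(xs, ys). (x # xs, y # ys))"
  have "bind_pmf (replicate_pmf (Suc n) W) ?R
      = bind_pmf W (\<lambda>w. bind_pmf (replicate_pmf n W) (\<lambda>ws. ?R (w # ws)))"
    by (simp only: replicate_pmf.simps bind_assoc_pmf bind_return_pmf)
  also have "\<dots> = bind_pmf W (\<lambda>w. bind_pmf (replicate_pmf n W) (\<lambda>ws.
      bind_pmf (pair_pmf (P w) (Q w)) (\<lambda>z. ?c z (?R ws))))"
    by (simp only: list.map pair_sequence_Cons case_prod_unfold)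
  also have "\<dots> = bind_pmf W (\<lambda>w. bind_pmf (pair_pmf (P w) (Q w)) (\<lambda>z.
      bind_pmf (replicate_pmf n W) (\<lambda>ws. ?c z (?R ws))))"
    by (intro bind_pmf_cong refl bind_commute_pmf)
  also have "\<dots> = bind_pmf W (\<lambda>w. bind_pmf (pair_pmf (P w) (Q w)) (\<lambda>z.
      ?c z (bind_pmf (replicate_pmf n W) ?R)))"
    by (simp only: map_bind_pmf case_prod_unfold)
  also have "\<dots> = bind_pmf p (\<lambda>z. ?c z (iid_pair n p))"
    using Suc.IH assms by (simp only: markov_decomposition_def bind_assoc_pmf[symmetric])
  also have "\<dots> = iid_pair (Suc n) p"
    by (simp only: iid_pair_Suc case_prod_unfold)
  finally show ?case by (simp only: markov_decomposition_def)
qed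

lemma finite_replicate_pmf: "finite (set_pmf p) \<Longrightarrow> finite (set_pmf (replicate_pmf n p))"
  by (simp add: set_replicate_pmf lists_eq_set finite_lists_length_eq)

definition zip_sum :: "('w \<Rightarrow> 'a \<Rightarrow> real) \<Rightarrow> 'w list \<Rightarrow> 'a list \<Rightarrow> real" where
  "zip_sum h ws xs = (\<Sum>(w, x)\<leftarrow>zip ws xs. h w x)"

lemma zip_sum_simps [simp]:
  "zip_sum h [] xs = 0" "zip_sum h (w # ws) (x # xs) = h w x + zip_sum h ws xs"
  by (simp_all add: zip_sum_def)

text \<open>The mean of \<open>h\<close> vanishes only after averaging over \<open>W\<close>, hence
  the moments are averaged over the word as well. In the square, the cross term factors into means
  and drops out.\<close>

lemma zip_sum_moments:
  fixes W :: "'w pmf" and P :: "'w \<Rightarrow> 'a pmf"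
  assumes finW: "finite (set_pmf W)" and finP: "\<And>w. w \<in> set_pmf W \<Longrightarrow> finite (set_pmf (P w))"
    and mean: "expect W (\<lambda>w. expect (P w) (h w)) = 0"
  shows "expect (replicate_pmf n W) (\<lambda>ws. expect (sequence_pmf (map P ws)) (zip_sum h ws)) = 0"
    and "expect (replicate_pmf n W) (\<lambda>ws. expect (sequence_pmf (map P ws)) (\<lambda>xs. (zip_sum h ws xs)\<^sup>2))
      = real n * expect W (\<lambda>w. expect (P w) (\<lambda>x. (h w x)\<^sup>2))"
proof (induction n)
  case (Suc n)
  let ?Rn = "replicate_pmf n W"
  let ?E = "\<lambda>ws. expect (sequence_pmf (map P ws))"
  have finR: "finite (set_pmf ?Rn)" by (rule finite_replicate_pmf[OF finW])
  have finS: "finite (set_pmf (sequence_pmf (map P ws)))" if "ws \<in> set_pmf ?Rn" for ws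
    using that finP by (intro finite_sequence_pmf) (auto simp: set_replicate_pmf)
  have step: "expect (replicate_pmf (Suc n) W) F = expect W (\<lambda>w. expect ?Rn (\<lambda>ws. F (w # ws)))" for F
    using finW finR by (simp add: expect_bind_finite)
  have inner: "?E (w # ws) G = expect (P w) (\<lambda>x. ?E ws (\<lambda>xs. G (x # xs)))"
    if "w \<in> set_pmf W" "ws \<in> set_pmf ?Rn" for w ws G
    using finP[OF that(1)] finS[OF that(2)] by (simp add: expect_bind_finite)
  {
    case 1
    have "expect (replicate_pmf (Suc n) W) (\<lambda>ws. ?E ws (zip_sum h ws))
        = expect W (\<lambda>w. expect ?Rn (\<lambda>ws. expect (P w) (h w) + ?E ws (zip_sum h ws)))"
      unfolding step
    proof (intro expect_cong_pmf)
      fix w ws assume w: "w \<in> set_pmf W" and ws: "ws \<in> set_pmf ?Rn"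
      show "?E (w # ws) (zip_sum h (w # ws)) = expect (P w) (h w) + ?E ws (zip_sum h ws)"
        by (subst inner[OF w ws])
          (simp add: expect_add_finite[OF finS[OF ws]] expect_add_finite[OF finP[OF w]])
    qed
    also have "\<dots> = 0" using mean Suc.IH(1) by (simp add: expect_add_finite[OF finR] expect_add_finite[OF finW])
    finally show ?case .
  next
    case 2
    have "expect (replicate_pmf (Suc n) W) (\<lambda>ws. ?E ws (\<lambda>xs. (zip_sum h ws xs)\<^sup>2))
        = expect W (\<lambda>w. expect ?Rn (\<lambda>ws. expect (P w) (\<lambda>x. (h w x)\<^sup>2)
          + (2 * expect (P w) (h w) * ?E ws (zip_sum h ws) + ?E ws (\<lambda>xs. (zip_sum h ws xs)\<^sup>2))))"
      unfolding step
    proof (intro expect_cong_pmf)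
      fix w ws assume w: "w \<in> set_pmf W" and ws: "ws \<in> set_pmf ?Rn"
      have "?E (w # ws) (\<lambda>xs. (zip_sum h (w # ws) xs)\<^sup>2)
          = expect (P w) (\<lambda>x. ?E ws (\<lambda>xs. (h w x)\<^sup>2 + ((2 * h w x) * zip_sum h ws xs + (zip_sum h ws xs)\<^sup>2)))"
        by (subst inner[OF w ws]) (simp add: power2_sum algebra_simps)
      also have "\<dots> = expect (P w) (\<lambda>x. (h w x)\<^sup>2 + ((2 * ?E ws (zip_sum h ws)) * h w x
          + ?E ws (\<lambda>xs. (zip_sum h ws xs)\<^sup>2)))"
        by (simp add: expect_add_finite[OF finS[OF ws]] mult_ac)
      also have "\<dots> = expect (P w) (\<lambda>x. (h w x)\<^sup>2)
          + (2 * expect (P w) (h w) * ?E ws (zip_sum h ws) + ?E ws (\<lambda>xs. (zip_sum h ws xs)\<^sup>2))"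
        by (simp add: expect_add_finite[OF finP[OF w]] mult_ac)
      finally show "?E (w # ws) (\<lambda>xs. (zip_sum h (w # ws) xs)\<^sup>2) = \<dots>" .
    qed
    also have "\<dots> = expect W (\<lambda>w. expect (P w) (\<lambda>x. (h w x)\<^sup>2)) + real n * expect W (\<lambda>w. expect (P w) (\<lambda>x. (h w x)\<^sup>2))"
      by (simp add: expect_add_finite[OF finR] expect_add_finite[OF finW] Suc.IH)
    finally show ?case by (simp add: algebra_simps)
  }
qed simp_all

text \<open>Chebyshev's inequality for each word, averaged over the words. The event is one-sided
  because the density bound asks only for upper bounds on the sums.\<close>

lemma zip_sum_deviation:
  fixes W :: "'w pmf" and P :: "'w \<Rightarrow> 'a pmf"
  assumes finW: "finite (set_pmf W)" and finP: "\<And>w. w \<in> set_pmf W \<Longrightarrow> finite (set_pmf (P w))"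
    and mean: "expect W (\<lambda>w. expect (P w) (h w)) = 0" and t: "0 < t"
  shows "expect (replicate_pmf n W) (\<lambda>ws. measure (sequence_pmf (map P ws)) (- {xs. zip_sum h ws xs \<le> t}))
      \<le> real n * expect W (\<lambda>w. expect (P w) (\<lambda>x. (h w x)\<^sup>2)) / t\<^sup>2"
proof -
  have "expect (replicate_pmf n W) (\<lambda>ws. measure (sequence_pmf (map P ws)) (- {xs. zip_sum h ws xs \<le> t}))
      \<le> expect (replicate_pmf n W) (\<lambda>ws. expect (sequence_pmf (map P ws)) (\<lambda>xs. (zip_sum h ws xs)\<^sup>2) / t\<^sup>2)"
  proof (rule expect_mono_finite[OF finite_replicate_pmf[OF finW]])
    fix ws assume "ws \<in> set_pmf (replicate_pmf n W)"
    then have fin: "finite (set_pmf (sequence_pmf (map P ws)))"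
      using finP by (intro finite_sequence_pmf) (auto simp: set_replicate_pmf)
    have "measure (sequence_pmf (map P ws)) (- {xs. zip_sum h ws xs \<le> t})
        = expect (sequence_pmf (map P ws)) (indicator (- {xs. zip_sum h ws xs \<le> t}))" by simp
    also have "\<dots> \<le> expect (sequence_pmf (map P ws)) (\<lambda>xs. (zip_sum h ws xs)\<^sup>2 / t\<^sup>2)"
    proof (rule expect_mono_finite[OF fin])
      fix xs
      show "indicator (- {xs. zip_sum h ws xs \<le> t}) xs \<le> (zip_sum h ws xs)\<^sup>2 / t\<^sup>2"
        using t by (auto simp: indicator_def le_divide_eq intro: power_mono)
    qed
    finally show "measure (sequence_pmf (map P ws)) (- {xs. zip_sum h ws xs \<le> t})
      \<le> expect (sequence_pmf (map P ws)) (\<lambda>xs. (zip_sum h ws xs)\<^sup>2) / t\<^sup>2" by simp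
  qed
  also have "\<dots> = real n * expect W (\<lambda>w. expect (P w) (\<lambda>x. (h w x)\<^sup>2)) / t\<^sup>2"
    using zip_sum_moments(2)[OF finW finP mean, of n] by simp
  finally show ?thesis .
qed

text \<open>The one-letter bounds multiply. The corrections \<open>h\<close> and \<open>k\<close>
  accumulate along \<open>xs\<close> and \<open>ys\<close> separately, which is what permits
  separate typical sets.\<close>

lemma sequence_density_le:
  assumes step: "\<And>w x y. w \<in> A \<Longrightarrow> x \<in> set_pmf (P w) \<Longrightarrow> y \<in> set_pmf (Q w) \<Longrightarrow>
      pmf (P w) x * pmf (Q w) y \<le> exp (c + h w x + k w y) * pmf p (x, y)"
    and "set ws \<subseteq> A" "length ws = n"
    and "xs \<in> set_pmf (sequence_pmf (map P ws))" "ys \<in> set_pmf (sequence_pmf (map Q ws))"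
  shows "length xs = n \<and> length ys = n \<and>
    pmf (sequence_pmf (map P ws)) xs * pmf (sequence_pmf (map Q ws)) ys
    \<le> exp (real n * c + zip_sum h ws xs + zip_sum k ws ys) * pmf (iid_pair n p) (xs, ys)"
  using assms(2-)
proof (induction ws arbitrary: n xs ys)
  case Nil
  then show ?case by (simp add: iid_pair_def)
next
  case (Cons w ws)
  obtain m where n: "n = Suc m" "length ws = m" using Cons.prems(2) by auto
  obtain x xs' where xs: "xs = x # xs'" "x \<in> set_pmf (P w)" "xs' \<in> set_pmf (sequence_pmf (map P ws))"
    using Cons.prems(3) by auto
  obtain y ys' where ys: "ys = y # ys'" "y \<in> set_pmf (Q w)" "ys' \<in> set_pmf (sequence_pmf (map Q ws))"
    using Cons.prems(4) by auto
  have IH: "length xs' = m \<and> length ys' = m \<and>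
    pmf (sequence_pmf (map P ws)) xs' * pmf (sequence_pmf (map Q ws)) ys'
    \<le> exp (real m * c + zip_sum h ws xs' + zip_sum k ws ys') * pmf (iid_pair m p) (xs', ys')"
    using Cons.IH[OF _ n(2) xs(3) ys(3)] Cons.prems(1) by simp
  have iid: "pmf (iid_pair n p) (xs, ys) = pmf p (x, y) * pmf (iid_pair m p) (xs', ys')"
    using IH unfolding n xs(1) ys(1) by (simp add: pmf_iid_pair prod.lessThan_Suc_shift del: prod.lessThan_Suc)
  have "pmf (sequence_pmf (map P (w # ws))) xs * pmf (sequence_pmf (map Q (w # ws))) ys
      = (pmf (P w) x * pmf (Q w) y) * (pmf (sequence_pmf (map P ws)) xs' * pmf (sequence_pmf (map Q ws)) ys')"
    by (simp only: list.map xs(1) ys(1) pmf_sequence_Cons mult_ac)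
  also have "\<dots> \<le> (exp (c + h w x + k w y) * pmf p (x, y))
      * (exp (real m * c + zip_sum h ws xs' + zip_sum k ws ys') * pmf (iid_pair m p) (xs', ys'))"
    using step[OF _ xs(2) ys(2)] Cons.prems(1) IH by (intro mult_mono[of "pmf (P w) x * pmf (Q w) y"]) auto
  also have "\<dots> = exp ((c + h w x + k w y) + (real m * c + zip_sum h ws xs' + zip_sum k ws ys'))
      * (pmf p (x, y) * pmf (iid_pair m p) (xs', ys'))"
    by (simp only: exp_add mult_ac)
  also have "(c + h w x + k w y) + (real m * c + zip_sum h ws xs' + zip_sum k ws ys')
      = real n * c + zip_sum h (w # ws) xs + zip_sum k (w # ws) ys"
    by (simp add: n xs(1) ys(1) algebra_simps)
  finally show ?case
    using IH xs(1) ys(1) n(1) unfolding iid by (intro conjI) (simp_all only: list.size)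
qed

lemma card_set_iid_pair_le:
  fixes p :: "('a::finite \<times> 'b::finite) pmf"
  shows "card (set_pmf (iid_pair n p)) \<le> CARD('a \<times> 'b) ^ n"
proof -
  have "card (set_pmf (iid_pair n p)) \<le> card (set_pmf (replicate_pmf n p))"
    unfolding iid_pair_def set_map_pmf by (intro card_image_le finite_replicate_pmf) simp
  also have "\<dots> \<le> card {xs :: ('a \<times> 'b) list. set xs \<subseteq> UNIV \<and> length xs = n}"
    by (intro card_mono finite_lists_length_eq) (auto simp: set_replicate_pmf)
  also have "\<dots> = CARD('a \<times> 'b) ^ n" by (rule card_lists_length_eq) simp
  finally show ?thesis .
qed

text \<open>Sum over the support of \<open>p\<close>. This makes the codebook constant
  \<open>K'\<close> at least one without knowing the sign of its exponent.\<close>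

lemma dominated_pmf_ge_1:
  assumes "finite (set_pmf p)" "\<And>z. pmf q z \<le> K * pmf p z"
  shows "1 \<le> K"
proof -
  have sub: "set_pmf q \<subseteq> set_pmf p"
  proof
    fix z assume "z \<in> set_pmf q"
    then have "0 < K * pmf p z" using pmf_positive assms(2) less_le_trans by metis
    then show "z \<in> set_pmf p" by (auto simp: set_pmf_iff)
  qed
  have "1 = (\<Sum>z\<in>set_pmf p. pmf q z)" using assms(1) sub by (simp add: sum_pmf_eq_1)
  also have "\<dots> \<le> (\<Sum>z\<in>set_pmf p. K * pmf p z)" by (intro sum_mono assms(2))
  also have "\<dots> = K" using assms(1) by (simp add: sum_distrib_left[symmetric] sum_pmf_eq_1)
  finally show ?thesis .
qed

section \<open>Achievability: choice of constants\<close>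

lemma eventually_ln_le_linear:
  fixes a b c :: real
  assumes "0 < a" "0 < c"
  shows "\<forall>\<^sub>F n in sequentially. b + ln (c * real n + 2) \<le> real n * a"
proof -
  \<comment> \<open>The bound \<open>ln t \<le> t - 1\<close> at this scale has slope
    \<open>d * c = a / 2\<close> in \<open>n\<close>; the other half of the linear growth absorbs
    the constants.\<close>
  define d where "d = a / (2 * c)"
  have d: "0 < d" using assms by (simp add: d_def)
  have "\<forall>\<^sub>F n in sequentially. 2 * (b + 2 * d - 1 - ln d) / a \<le> real n"
    by (rule eventually_ge_at_top[THEN filterlim_real_sequentially[unfolded filterlim_iff, rule_format]])
  then show ?thesis
  proof eventually_elim
    case (elim n)
    have "ln (d * (c * real n + 2)) \<le> d * (c * real n + 2) - 1"
      using d assms by (intro ln_le_minus_one mult_pos_pos add_nonneg_pos) auto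
    moreover have "ln (d * (c * real n + 2)) = ln d + ln (c * real n + 2)"
      using d assms by (intro ln_mult_pos add_nonneg_pos) auto
    moreover have "d * (c * real n + 2) = d * c * real n + 2 * d" by (simp add: algebra_simps)
    ultimately have "ln (c * real n + 2) \<le> d * c * real n + 2 * d - 1 - ln d" by linarith
    moreover have "d * c * real n = real n * a / 2" using assms by (simp add: d_def)
    moreover have "b + 2 * d - 1 - ln d \<le> real n * a / 2"
      using elim assms by (simp add: divide_le_eq)
    ultimately show ?case by linarith
  qed
qed

text \<open>The product of the two losses is at least \<open>1 - 4 * s = 1 - \<eta> / 2\<close>, and
  \<open>(1 + \<eta>) * (1 - \<eta> / 2) \<ge> 1\<close> for \<open>\<eta> \<le> 1\<close>.\<close>

lemma codebook_parameters:
  fixes \<eta> s :: real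
  assumes "0 < \<eta>" "\<eta> \<le> 1" "s = \<eta> / 8"
  shows "1 \<le> (1 + \<eta>) * ((1 - 2 * s) * (1 - s)\<^sup>2)"
proof -
  have "\<eta> * \<eta> \<le> \<eta> * 1" using assms by (intro mult_left_mono) auto
  moreover have "(1 + \<eta>) * (1 - 4 * s) = 1 + \<eta> / 2 - \<eta> * \<eta> / 2"
    by (simp add: assms(3) field_simps)
  ultimately have "1 \<le> (1 + \<eta>) * (1 - 4 * s)" using assms(1) by linarith
  also have "1 - 4 * s \<le> (1 - 2 * s) * (1 - 2 * s)" by (simp add: algebra_simps)
  then have "(1 + \<eta>) * (1 - 4 * s) \<le> (1 + \<eta>) * ((1 - 2 * s) * (1 - 2 * s))"
    using assms by (intro mult_left_mono) auto
  also have "1 - 2 * s \<le> (1 - s)\<^sup>2" by (simp add: power2_eq_square algebra_simps)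
  then have "(1 + \<eta>) * ((1 - 2 * s) * (1 - 2 * s)) \<le> (1 + \<eta>) * ((1 - 2 * s) * (1 - s)\<^sup>2)"
    using assms by (intro mult_left_mono) auto
  finally show ?thesis .
qed

text \<open>Achievability from one fixed single-letter decomposition with value \<open>V\<close>.
  Nonnegativity of the exponent is part of the conclusion because \<open>ennreal\<close> would
  otherwise truncate it.\<close>

lemma eventually_entropy_le:
  fixes \<pi> :: "('a::finite \<times> 'b::finite) pmf" and W :: "'w pmf"
  assumes md: "markov_decomposition \<pi> W P Q" and finW: "finite (set_pmf W)" and \<epsilon>: "0 < \<epsilon>"
  defines "V \<equiv> expect W (\<lambda>w. transport \<pi> (P w) (Q w) - ent (P w) - ent (Q w))"
  shows "\<forall>\<^sub>F n in sequentially. 0 \<le> real n * (V + \<epsilon>) \<and> (\<exists>(W' :: nat pmf) P' Q'.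
    markov_decomposition (iid_pair n \<pi>) W' P' Q' \<and> shannon_entropy W' \<le> ennreal (real n * (V + \<epsilon>)))"
proof -
  \<comment> \<open>The budget: \<open>3 * \<delta> = \<epsilon> / 4\<close> covers the potentials
    and the deviations of both sequences, the rest of the code takes
    \<open>4 * \<eta> * L \<le> \<epsilon> / 4\<close>, and the logarithmic terms take
    \<open>\<epsilon> / 2\<close>.\<close>
  define \<delta> where "\<delta> = \<epsilon> / 12"
  define L where "L = ln (CARD('a \<times> 'b))"
  \<comment> \<open>\<open>L + 1\<close> in place of \<open>L\<close> avoids division by zero for
    one-point alphabets.\<close>
  define \<eta> where "\<eta> = min 1 (\<epsilon> / (16 * (L + 1)))"
  define s where "s = \<eta> / 8"
  define L1 where "L1 = ln (1 + \<eta>)"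
  have \<delta>: "0 < \<delta>" using \<epsilon> by (simp add: \<delta>_def)
  have card: "0 < CARD('a \<times> 'b)" by (rule zero_less_card_finite)
  then have "1 \<le> CARD('a \<times> 'b)" by linarith
  then have "real 1 \<le> real CARD('a \<times> 'b)" by (rule of_nat_mono)
  then have L: "0 \<le> L" unfolding L_def by (intro ln_ge_zero) (simp only: of_nat_1)
  have "0 < \<epsilon> / (16 * (L + 1))" using \<epsilon> L by simp
  then have \<eta>: "0 < \<eta>" "\<eta> \<le> 1" unfolding \<eta>_def by (simp, intro min.cobounded1)
  have \<eta>L: "4 * \<eta> * L \<le> \<epsilon> / 4"
  proof -
    have "\<eta> * (L + 1) \<le> \<epsilon> / (16 * (L + 1)) * (L + 1)"
      unfolding \<eta>_def using L by (intro mult_right_mono min.cobounded2) auto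
    also have "\<dots> = \<epsilon> / 16"
    proof -
      have "a / (16 * M) * M = a / 16" if "M \<noteq> 0" for a M :: real using that by simp
      from this[of "L + 1" \<epsilon>] show ?thesis using L by linarith
    qed
    finally show ?thesis using \<eta> by (simp add: algebra_simps)
  qed
  have L1: "0 < L1" using \<eta> by (simp add: L1_def)
  have s: "0 < s" "s < 1/2" using \<eta> by (auto simp: s_def)
  have supp: "set_pmf (P w) \<times> set_pmf (Q w) \<subseteq> set_pmf \<pi>" if "w \<in> set_pmf W" for w
    by (rule set_markov_decomposition[OF md that])
  have "\<forall>w\<in>set_pmf W. \<exists>f g. (\<forall>x\<in>set_pmf (P w). \<forall>y\<in>set_pmf (Q w). - ln (pmf \<pi> (x, y)) \<le> f x + g y)
      \<and> expect (P w) f + expect (Q w) g \<le> transport \<pi> (P w) (Q w) + \<delta>"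
    using kantorovich_potentials[OF supp \<delta>] by metis
  then obtain f g where fg:
    "\<And>w x y. w \<in> set_pmf W \<Longrightarrow> x \<in> set_pmf (P w) \<Longrightarrow> y \<in> set_pmf (Q w) \<Longrightarrow>
      - ln (pmf \<pi> (x, y)) \<le> f w x + g w y"
    "\<And>w. w \<in> set_pmf W \<Longrightarrow> expect (P w) (f w) + expect (Q w) (g w) \<le> transport \<pi> (P w) (Q w) + \<delta>"
    by metis
  \<comment> \<open>Averaged, the potential minus the entropy on each side. The sum
    \<open>hX + hY\<close> dominates the log density ratio, and the means of the two add up to at
    most \<open>V + \<delta>\<close>.\<close>
  define hX where "hX w x = f w x + ln (pmf (P w) x)" for w x
  define hY where "hY w y = g w y + ln (pmf (Q w) y)" for w y
  define mX where "mX = expect W (\<lambda>w. expect (P w) (hX w))"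
  define mY where "mY = expect W (\<lambda>w. expect (Q w) (hY w))"
  define kX where "kX w x = hX w x + - mX" for w x
  define kY where "kY w y = hY w y + - mY" for w y
  have meanX: "expect W (\<lambda>w. expect (P w) (kX w)) = 0"
    unfolding kX_def by (simp add: expect_add_finite expect_add_finite[OF finW] mX_def del: add_uminus_conv_diff)
  have meanY: "expect W (\<lambda>w. expect (Q w) (kY w)) = 0"
    unfolding kY_def by (simp add: expect_add_finite expect_add_finite[OF finW] mY_def del: add_uminus_conv_diff)
  have mXY: "mX + mY \<le> V + \<delta>"
  proof -
    have hX: "expect (P w) (hX w) = expect (P w) (f w) - ent (P w)"
      and hY: "expect (Q w) (hY w) = expect (Q w) (g w) - ent (Q w)" for w
      unfolding hX_def hY_def ent_def by (simp_all add: expect_add_finite)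
    have "mX + mY = expect W (\<lambda>w. expect (P w) (hX w) + expect (Q w) (hY w))"
      by (simp add: mX_def mY_def expect_add_finite[OF finW])
    also have "\<dots> \<le> expect W (\<lambda>w. (transport \<pi> (P w) (Q w) - ent (P w) - ent (Q w)) + \<delta>)"
    proof (rule expect_mono_finite[OF finW])
      fix w assume "w \<in> set_pmf W"
      from fg(2)[OF this] show "expect (P w) (hX w) + expect (Q w) (hY w)
        \<le> (transport \<pi> (P w) (Q w) - ent (P w) - ent (Q w)) + \<delta>"
        unfolding hX hY by linarith
    qed
    also have "\<dots> = V + \<delta>" unfolding V_def by (subst expect_add_finite[OF finW]) simp
    finally show ?thesis .
  qed
  have density: "pmf (P w) x * pmf (Q w) y \<le> exp ((V + \<delta>) + kX w x + kY w y) * pmf \<pi> (x, y)"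
    if w: "w \<in> set_pmf W" and x: "x \<in> set_pmf (P w)" and y: "y \<in> set_pmf (Q w)" for w x y
  proof -
    have pos: "0 < pmf (P w) x" "0 < pmf (Q w) y" "0 < pmf \<pi> (x, y)"
      using x y supp[OF w] by (auto intro!: pmf_positive)
    have "pmf (P w) x * pmf (Q w) y = exp (ln (pmf (P w) x) + ln (pmf (Q w) y))"
      using pos by (simp add: exp_add)
    also have "\<dots> \<le> exp (((V + \<delta>) + kX w x + kY w y) + ln (pmf \<pi> (x, y)))"
      using fg(1)[OF w x y] mXY by (simp add: kX_def kY_def hX_def hY_def)
    also have "\<dots> = exp ((V + \<delta>) + kX w x + kY w y) * pmf \<pi> (x, y)"
      using pos by (simp only: exp_add exp_ln)
    finally show ?thesis .
  qed
  define vX where "vX = expect W (\<lambda>w. expect (P w) (\<lambda>x. (kX w x)\<^sup>2))"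
  define vY where "vY = expect W (\<lambda>w. expect (Q w) (\<lambda>x. (kY w x)\<^sup>2))"
  have vnn: "0 \<le> vX" "0 \<le> vY" unfolding vX_def vY_def by (auto intro!: integral_nonneg_AE)
  define c where "c = L / (\<eta> * L1) + 1"
  have c: "0 < c" using L \<eta> L1 by (auto simp: c_def intro!: add_nonneg_pos divide_nonneg_pos mult_pos_pos)
  have ev1: "\<forall>\<^sub>F n in sequentially. (3 * ln 2) + ln (c * real n + 2) \<le> real n * (\<epsilon> / 2)"
    using \<epsilon> c by (intro eventually_ln_le_linear) auto
  \<comment> \<open>From this \<open>n\<close> on, the Chebyshev bounds at deviation
    \<open>real n * \<delta>\<close> are at most \<open>s^2\<close>.\<close>
  have ev2: "\<forall>\<^sub>F n in sequentially. max 1 ((vX + vY) / (\<delta>\<^sup>2 * s\<^sup>2)) \<le> real n"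
    by (rule eventually_ge_at_top[THEN filterlim_real_sequentially[unfolded filterlim_iff, rule_format]])
  from ev1 ev2 show ?thesis
  proof eventually_elim
    case (elim n)
    let ?p = "iid_pair n \<pi>"
    let ?U = "replicate_pmf n W"
    let ?A = "\<lambda>ws. sequence_pmf (map P ws)"
    let ?B = "\<lambda>ws. sequence_pmf (map Q ws)"
    let ?S = "set_pmf ?p"
    have n: "0 < real n" using elim(2) by simp
    have nv: "vX + vY \<le> real n * (\<delta>\<^sup>2 * s\<^sup>2)"
      using elim(2) \<delta> s by (simp add: divide_le_eq)
    define K where "K = exp (real n * (V + 3 * \<delta>))"
    have finU: "finite (set_pmf ?U)" by (rule finite_replicate_pmf[OF finW])
    have finS: "finite ?S" by (rule finite_set_iid_pair)
    have bound: "real n * v / (real n * \<delta>)\<^sup>2 \<le> s\<^sup>2" if "v \<le> real n * (\<delta>\<^sup>2 * s\<^sup>2)" for v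
    proof -
      have "real n * v / (real n * \<delta>)\<^sup>2 = v / (real n * \<delta>\<^sup>2)"
        using n by (simp add: power2_eq_square)
      also have "\<dots> \<le> s\<^sup>2" using that n \<delta> by (simp add: divide_le_eq mult_ac)
      finally show ?thesis .
    qed
    have badX: "expect ?U (\<lambda>ws. measure (?A ws) (- {xs. zip_sum kX ws xs \<le> real n * \<delta>})) \<le> s\<^sup>2"
      using zip_sum_deviation[OF finW _ meanX, of "real n * \<delta>" n] bound[of vX] nv vnn n \<delta>
      unfolding vX_def[symmetric] by (auto intro: order_trans)
    have badY: "expect ?U (\<lambda>ws. measure (?B ws) (- {ys. zip_sum kY ws ys \<le> real n * \<delta>})) \<le> s\<^sup>2"
      using zip_sum_deviation[OF finW _ meanY, of "real n * \<delta>" n] bound[of vY] nv vnn n \<delta>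
      unfolding vY_def[symmetric] by (auto intro: order_trans)
    have good: "pmf (?A ws) xs * pmf (?B ws) ys \<le> K * pmf ?p (xs, ys)"
      if "ws \<in> set_pmf ?U" "xs \<in> set_pmf (?A ws)" "ys \<in> set_pmf (?B ws)"
        "xs \<in> {xs. zip_sum kX ws xs \<le> real n * \<delta>}" "ys \<in> {ys. zip_sum kY ws ys \<le> real n * \<delta>}"
      for ws xs ys
    proof -
      have ws: "set ws \<subseteq> set_pmf W" "length ws = n" using that(1) by (auto simp: set_replicate_pmf)
      have "pmf (?A ws) xs * pmf (?B ws) ys
          \<le> exp (real n * (V + \<delta>) + zip_sum kX ws xs + zip_sum kY ws ys) * pmf ?p (xs, ys)"
        using sequence_density_le[OF density ws that(2,3)] by blast
      also have "\<dots> \<le> K * pmf ?p (xs, ys)"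
        unfolding K_def using that(4,5) by (intro mult_right_mono) (auto simp: algebra_simps)
      finally show ?thesis .
    qed
    obtain U' A' B' where U': "set_pmf U' \<subseteq> set_pmf ?U"
      "\<And>u z. u \<in> set_pmf U' \<Longrightarrow> pmf (pair_pmf (A' u) (B' u)) z \<le> (1 + \<eta>) * K * pmf ?p z"
      "\<And>z. pmf (bind_pmf U' (\<lambda>u. pair_pmf (A' u) (B' u))) z \<le> (1 + \<eta>) * pmf ?p z"
      using condition_kernels[OF finU markov_decomposition_iid[OF md] badX badY good _ s
          codebook_parameters[OF \<eta> s_def]] by (auto simp: K_def)
    have finU': "finite (set_pmf U')" using U'(1) finU finite_subset by blast
    define K' where "K' = (1 + \<eta>) * K"
    obtain u where "u \<in> set_pmf U'" using set_pmf_not_empty by fast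
    then have K': "1 \<le> K'" using dominated_pmf_ge_1[OF finS U'(2)] by (simp add: K'_def)
    have cardS: "0 < card ?S" using finS by (simp add: card_gt_0_iff set_pmf_not_empty)
    have lnS: "ln (card ?S) \<le> real n * L"
    proof -
      have "ln (real (card ?S)) \<le> ln (real (CARD('a \<times> 'b) ^ n))"
        using cardS card_set_iid_pair_le[of n \<pi>] by (subst ln_le_cancel_iff) (auto simp del: of_nat_power)
      also have "\<dots> = real n * L" using card by (simp add: L_def ln_realpow)
      finally show ?thesis .
    qed
    have lnS0: "0 \<le> ln (card ?S)" using cardS by simp
    \<comment> \<open>Adding one keeps the codebook nonempty even when the support of
      \<open>?p\<close> is a single point and the quotient is zero.\<close>
    define N where "N = nat \<lceil>K' * ln (card ?S) / (\<eta> * L1)\<rceil> + 1"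
    have q0: "0 \<le> K' * ln (card ?S) / (\<eta> * L1)" using K' lnS0 \<eta> L1 by simp
    have N1: "K' * ln (card ?S) / (\<eta> * L1) \<le> real N" unfolding N_def by linarith
    have N2: "real N \<le> K' * ln (card ?S) / (\<eta> * L1) + 2" unfolding N_def using q0 by linarith
    have Npos: "0 < N" by (simp add: N_def)
    have "K' * ln (card ?S) \<le> real N * (\<eta> * ln (1 + \<eta>))"
      using N1 \<eta> L1 by (simp add: divide_le_eq L1_def)
    then obtain us where us: "length us = N"
      "\<And>z. (\<Sum>u\<leftarrow>us. pmf (pair_pmf (A' u) (B' u)) z) \<le> real N * (1 + 4 * \<eta>) * pmf ?p z"
      using covering_codebook[OF finS finU' _ \<eta> U'(2)[folded K'_def] U'(3), of N] K' by auto
    have "(\<Sum>i<N. pmf (pair_pmf (A' (us ! i)) (B' (us ! i))) z) \<le> real N * (1 + 4 * \<eta>) * pmf ?p z" for z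
      using us(2)[of z] by (simp add: sum_list_sum_nth us(1) atLeast0LessThan)
    then obtain W' :: "nat pmf" and P' Q' where W': "markov_decomposition ?p W' P' Q'"
      "shannon_entropy W' \<le> ennreal (ln 2 + ln N + 4 * \<eta> * ln (card ?S))"
      using codebook_decomposition[OF finS _ Npos, of "4 * \<eta>" "\<lambda>i. A' (us ! i)" "\<lambda>i. B' (us ! i)"] \<eta>(1)
      by (metis mult_pos_pos zero_less_numeral)
    have lnN: "ln N \<le> ln 2 + real n * (V + 3 * \<delta>) + ln (c * real n + 2)"
    proof -
      have "K' * ln (card ?S) / (\<eta> * L1) \<le> K' * (real n * L) / (\<eta> * L1)"
        using lnS K' \<eta> L1 by (intro divide_right_mono mult_left_mono) auto
      also have "\<dots> = K' * (real n * (L / (\<eta> * L1)))" by simp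
      also have "\<dots> \<le> K' * (real n * c)"
        using K' by (intro mult_left_mono) (auto simp: c_def)
      \<comment> \<open>Since \<open>K' \<ge> 1\<close>, the rounding error 2 is absorbed into the
        factor \<open>K'\<close>, leaving only a logarithm of a linear function of
        \<open>n\<close>.\<close>
      finally have "real N \<le> K' * (real n * c) + K' * 2" using N2 K' by linarith
      also have "\<dots> = K' * (c * real n + 2)" by (simp add: algebra_simps)
      finally have "ln N \<le> ln (K' * (c * real n + 2))"
        using Npos by (subst ln_le_cancel_iff) auto
      also have "\<dots> = ln (1 + \<eta>) + real n * (V + 3 * \<delta>) + ln (c * real n + 2)"
      proof -
        have "0 < c * real n + 2" using c by (intro add_nonneg_pos) auto
        then show ?thesis using \<eta> by (simp add: K'_def K_def ln_mult)
      qed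
      finally have "ln N \<le> ln (1 + \<eta>) + real n * (V + 3 * \<delta>) + ln (c * real n + 2)" .
      moreover have "ln (1 + \<eta>) \<le> ln 2" using \<eta> by simp
      ultimately show ?thesis by linarith
    qed
    have "4 * \<eta> * ln (card ?S) \<le> 4 * \<eta> * (real n * L)" using lnS \<eta> by (intro mult_left_mono) auto
    also have "\<dots> = real n * (4 * \<eta> * L)" by simp
    also have "\<dots> \<le> real n * (\<epsilon> / 4)" using \<eta>L by (intro mult_left_mono) auto
    finally have "ln 2 + ln N + 4 * \<eta> * ln (card ?S)
        \<le> real n * (V + 3 * \<delta>) + real n * (\<epsilon> / 4) + (3 * ln 2 + ln (c * real n + 2))"
      using lnN ln_ge_zero[of 2] by linarith
    also have "\<dots> \<le> real n * (V + 3 * \<delta>) + real n * (\<epsilon> / 4) + real n * (\<epsilon> / 2)"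
      using elim(1) by linarith
    also have "\<dots> = real n * (V + \<epsilon>)" by (simp add: \<delta>_def algebra_simps)
    finally have le: "ln 2 + ln N + 4 * \<eta> * ln (card ?S) \<le> real n * (V + \<epsilon>)" .
    then have "shannon_entropy W' \<le> ennreal (real n * (V + \<epsilon>))"
      using W'(2) by (meson ennreal_leI order_trans)
    moreover have "0 \<le> real n * (V + \<epsilon>)"
    proof -
      have "0 \<le> ln (2 :: real)" "0 \<le> ln (real N)" "0 \<le> 4 * \<eta> * ln (card ?S)"
        using Npos \<eta> lnS0 by auto
      then show ?thesis using le by linarith
    qed
    ultimately show ?case using W'(1) by blast
  qed
qed

section \<open>Passing to the limit\<close>

lemma eventually_exact_rate_le:
  fixes \<pi> :: "('a::finite \<times> 'b::finite) pmf" and W :: "'w pmf"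
  assumes "markov_decomposition \<pi> W P Q" "finite (set_pmf W)" "0 < \<epsilon>"
  shows "\<forall>\<^sub>F n in sequentially. exact_rate \<pi> n
    \<le> ereal (expect W (\<lambda>w. transport \<pi> (P w) (Q w) - ent (P w) - ent (Q w)) + \<epsilon>)"
  using eventually_entropy_le[OF assms] eventually_gt_at_top[of 0]
proof eventually_elim
  case (elim n)
  let ?v = "expect W (\<lambda>w. transport \<pi> (P w) (Q w) - ent (P w) - ent (Q w)) + \<epsilon>"
  let ?I = "INF (W, P, Q) \<in> {(W :: nat pmf, P, Q). markov_decomposition (iid_pair n \<pi>) W P Q}. shannon_entropy W"
  obtain W' :: "nat pmf" and P' Q' where W': "markov_decomposition (iid_pair n \<pi>) W' P' Q'"
    "shannon_entropy W' \<le> ennreal (real n * ?v)"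
    using elim(1) by blast
  have "?I \<le> ennreal (real n * ?v)"
    using W' by (intro INF_lower2[of "(W', P', Q')"]) auto
  then have "enn2ereal ?I \<le> enn2ereal (ennreal (real n * ?v))"
    by (simp add: less_eq_ennreal.rep_eq)
  also have "\<dots> = ereal (real n * ?v)" using elim(1) by simp
  finally have "exact_rate \<pi> n \<le> ereal (real n * ?v) / ereal (real n)"
    unfolding exact_rate_def using elim(2) by (intro ereal_divide_right_mono) auto
  also have "\<dots> = ereal ?v" using elim(2) by simp
  finally show ?case .
qed

text \<open>\<open>lim\<close> alone does not certify that a limit exists, so convergence is
  asserted as well. Both follow from the order criterion: \<open>dual_certificate\<close> serves
  below \<open>Gamma_functional \<pi>\<close>, near-optimal decompositions above it.\<close>

theorem theorem2:
  fixes \<pi> :: "('a::finite \<times> 'b::finite) pmf"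
  shows "convergent (exact_rate \<pi>) \<and> exact_common_information \<pi> = Gamma_functional \<pi>"
proof -
  have "(exact_rate \<pi> \<longlongrightarrow> Gamma_functional \<pi>) sequentially"
  proof (rule order_tendstoI)
    fix a assume "a < Gamma_functional \<pi>"
    then obtain b where b: "a < b" "b < Gamma_functional \<pi>" using dense by blast
    obtain g where g: "b < ereal g" "ereal g < Gamma_functional \<pi>" using ereal_dense2[OF b(2)] by blast
    obtain \<phi> where \<phi>: "coupling_bound (\<lambda>x y. (x, y) \<in> set_pmf \<pi>) (\<lambda>z. - ln (pmf \<pi> z)) \<phi>"
      "g \<le> expect \<pi> \<phi>"
      using dual_certificate[OF g(2)] .
    show "\<forall>\<^sub>F n in sequentially. a < exact_rate \<pi> n"
      using eventually_gt_at_top[of 0]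
    proof eventually_elim
      case (elim n)
      let ?I = "INF (W, P, Q) \<in> {(W :: nat pmf, P, Q). markov_decomposition (iid_pair n \<pi>) W P Q}. shannon_entropy W"
      have "ennreal (real n * expect \<pi> \<phi>) \<le> ?I"
        by (intro INF_greatest) (auto intro: entropy_ge_of_coupling_bound[OF \<phi>(1)])
      then have "enn2ereal (ennreal (real n * expect \<pi> \<phi>)) \<le> enn2ereal ?I"
        by (simp add: less_eq_ennreal.rep_eq)
      \<comment> \<open>If \<open>expect \<pi> \<phi>\<close> is negative, \<open>ennreal\<close>
        replaces it by zero, which only raises the right-hand side.\<close>
      moreover have "ereal (real n * g) \<le> enn2ereal (ennreal (real n * expect \<pi> \<phi>))"
      proof -
        have "real n * g \<le> real n * expect \<pi> \<phi>" using \<phi>(2) by (intro mult_left_mono) auto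
        then have "ereal (real n * g) \<le> ereal (max 0 (real n * expect \<pi> \<phi>))"
          unfolding ereal_less_eq(3) by (rule max.coboundedI2)
        also have "\<dots> = enn2ereal (ennreal (real n * expect \<pi> \<phi>))"
          by (simp add: ennreal.rep_eq max_def)
        finally show ?thesis .
      qed
      ultimately have "ereal (real n * g) / ereal (real n) \<le> exact_rate \<pi> n"
        unfolding exact_rate_def using elim by (intro ereal_divide_right_mono) auto
      then have "ereal g \<le> exact_rate \<pi> n" using elim by simp
      then show ?case using b(1) g(1) by (meson less_le_trans less_trans)
    qed
  next
    fix a assume "Gamma_functional \<pi> < a"
    then obtain W :: "nat pmf" and P Q where W: "finite (set_pmf W)" "markov_decomposition \<pi> W P Q"
      "(\<Sum>w\<in>set_pmf W. ereal (pmf W w) * Phi (log_cost \<pi>) (P w) (Q w)) < a"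
      unfolding Gamma_functional_def INF_less_iff by auto
    let ?v = "expect W (\<lambda>w. transport \<pi> (P w) (Q w) - ent (P w) - ent (Q w))"
    have "(\<Sum>w\<in>set_pmf W. ereal (pmf W w) * Phi (log_cost \<pi>) (P w) (Q w))
        = (\<Sum>w\<in>set_pmf W. ereal (pmf W w * (transport \<pi> (P w) (Q w) - ent (P w) - ent (Q w))))"
      by (intro sum.cong refl) (simp add: Phi_eq[OF set_markov_decomposition[OF W(2)]])
    also have "\<dots> = ereal ?v"
      using W(1) by (subst integral_measure_pmf_real[of "set_pmf W"]) (auto simp: mult.commute)
    finally have "ereal ?v < a" using W(3) by simp
    \<comment> \<open>The gap between \<open>r\<close> and the value of the decomposition is the
      \<open>\<epsilon>\<close> granted to the codebook.\<close>
    then obtain r where r: "ereal ?v < ereal r" "ereal r < a" using ereal_dense2 by blast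
    have "\<forall>\<^sub>F n in sequentially. exact_rate \<pi> n \<le> ereal (?v + (r - ?v))"
      using r(1) by (intro eventually_exact_rate_le W) simp
    then show "\<forall>\<^sub>F n in sequentially. exact_rate \<pi> n < a"
      by eventually_elim (use r(2) in \<open>auto intro: le_less_trans\<close>)
  qed
  then show ?thesis
    unfolding exact_common_information_def by (metis convergentI limI)
qed

end
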